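(* Let $m,n\ge 1$ be integers and let $A$ be a random complex $m\times(m+n)$ matrix whose $m(m+n)$ entries have joint probability density $G(A)=f(\mathrm{tr}\,AA^\dagger)$ with respect to the Cartesian (Lebesgue) measure $dA=\prod_{i,\alpha}d\,\mathrm{Re}A_{i\alpha}\,d\,\mathrm{Im}A_{i\alpha}$, where $f:(0,\infty)\to[0,\infty)$ is a measurable function satisfying $$\int_0^\infty u^{m(m+n)-1}f(u)\,du=\frac{2}{S_{2m(m+n)}}.$$ Partition the columns of $A$ into an $m\times m$ matrix $B$ (any $m$ chosen columns of $A$) and an $m\times n$ matrix $X$ (the remaining $n$ columns). Then the joint probability density of the $mn$ entries of the complex random matrix $Z=B^{-1}X$ is independent of $f$ and is given by the universal function $$P(Z)=\frac{C}{\left[\det(\mathbf{1}+ZZ^\dagger)\right]^{m+n}},$$ where $\mathbf 1$ is the $m\times m$ identity matrix and $C$ is the normalization constant $$C=\int dB\, f(\mathrm{tr}\,BB^\dagger)\,|\det B|^{2n},$$ the integral being over all complex $m\times m$ matrices $B$.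
   Context: $S_d=\frac{2\pi^{d/2}}{\Gamma(d/2)}$ denotes the surface area of the unit sphere embedded in $d$ dimensions. $\dagger$ denotes conjugate transpose. Measures on complex matrices are Cartesian: the product over all entries of the Lebesgue measures of their real and imaginary parts (so $dB=\prod_{i,j}d\,\mathrm{Re}B_{ij}\,d\,\mathrm{Im}B_{ij}$, and similarly for $dX$, $dZ$); the density $P(Z)$ is with respect to $dZ$, with $\int P(Z)\,dZ=1$. One has $\mathrm{tr}\,AA^\dagger=\sum_{i,\alpha}|A_{i\alpha}|^2$. The integral condition on $f$ is equivalent to $\int G(A)\,dA=1$. "Independent of $f$" means that the same density, with the same constant $C$ depending only on $m$ and $n$, is obtained for every admissible $f$. *)

theory Defs
  imports "HOL-Probability.Probability"
begin

text \<open>\<open>lborel\<close> on \<open>complex^'n^'m\<close> is the Cartesian measure: the canonical basis of this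
  Euclidean space consists of \<open>axis i (axis j 1)\<close> and \<open>axis i (axis j \<i>)\<close>. On singular
  matrices \<open>matrix_inv\<close> is one fixed arbitrary matrix; a square block of a matrix having a
  Lebesgue density is singular with probability 0.\<close>

definition sphere_area :: "nat \<Rightarrow> real" where
  "sphere_area d = 2 * pi powr (real d / 2) / Gamma (real d / 2)"

definition conj_transpose :: "complex^'n^'m \<Rightarrow> complex^'m^'n" where
  "conj_transpose A = (\<chi> i j. cnj (A $ j $ i))"

definition select_columns :: "('j \<Rightarrow> 'k) \<Rightarrow> 'a^'k^'m \<Rightarrow> 'a^'j^'m" where
  "select_columns c A = (\<chi> i j. A $ i $ c j)"

text \<open>The maps \<open>b\<close> and \<open>x\<close> list the columns forming the square block and the remaining
  columns, in an arbitrary order; they force \<open>CARD('k) = CARD('m) + CARD('n)\<close>.\<close>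

definition column_partition :: "('m \<Rightarrow> 'k) \<Rightarrow> ('n \<Rightarrow> 'k) \<Rightarrow> bool" where
  "column_partition b x \<longleftrightarrow>
     inj b \<and> inj x \<and> range b \<inter> range x = {} \<and> range b \<union> range x = UNIV"

text \<open>The traces and determinants below are real (see the two lemmas at the end), so taking
  \<^const>\<open>Re\<close> only changes the type.\<close>

definition tr_sq :: "complex^'n^'m \<Rightarrow> real" where
  "tr_sq A = Re (trace (A ** conj_transpose A))"

definition det_one_plus :: "complex^'n^'m \<Rightarrow> real" where
  "det_one_plus Z = Re (det (mat 1 + Z ** conj_transpose Z))"

text \<open>Only the values of \<open>f\<close> on the open half-line are constrained; the value at 0 is junk and
  matters only at the zero matrix, a null set. The right-hand side of the integral condition is
  positive and a non-integrable function has Bochner integral 0, so the condition includes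
  integrability.\<close>

definition admissible :: "nat \<Rightarrow> nat \<Rightarrow> (real \<Rightarrow> real) \<Rightarrow> bool" where
  "admissible m n f \<longleftrightarrow>
     f \<in> borel_measurable (restrict_space borel {0<..}) \<and>
     (\<forall>u>0. 0 \<le> f u) \<and>
     (LBINT u:{0<..}. u ^ (m * (m + n) - 1) * f u) = 2 / sphere_area (2 * m * (m + n))"

lemma trace_conj_transpose:
  "trace (A ** conj_transpose A) = complex_of_real (\<Sum>i\<in>UNIV. \<Sum>j\<in>UNIV. (cmod (A $ i $ j))\<^sup>2)"
  by (simp add: trace_def matrix_matrix_mult_def conj_transpose_def complex_norm_square
      del: of_real_power)

lemma det_one_plus_real:
  fixes Z :: "complex^'n^'m"
  shows "det (mat 1 + Z ** conj_transpose Z) \<in> \<real>"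
proof -
  let ?H = "mat 1 + Z ** conj_transpose Z"
  have H: "cnj (?H $ i $ j) = transpose ?H $ i $ j" for i j
    by (simp add: mat_def matrix_matrix_mult_def conj_transpose_def transpose_def mult.commute)
  have "cnj (det ?H) = det (transpose ?H)"
    unfolding det_def H[symmetric] by simp
  then show ?thesis
    by (simp add: det_transpose Reals_cnj_iff)
qed

end

theory Submission
  imports Defs
begin

text \<open>
  Write \<open>A = [B | X] = B [1 | Z]\<close> up to the order of the columns, with \<open>B\<close> invertible almost surely
  (\<open>AE_det_nonzero\<close>). For fixed \<open>B\<close> the substitution \<open>X = B Z\<close> has real Jacobian \<open>\<bar>det B\<bar>\<close> to the
  power \<open>2n\<close>, so the density of \<open>Z\<close> is the integral over \<open>B\<close> of that factor times
  \<open>f (tr B (1 + Z Z\<^sup>\<dagger>) B\<^sup>\<dagger>)\<close>. If \<open>T (1 + Z Z\<^sup>\<dagger>) T\<^sup>\<dagger> = 1\<close>, replacing \<open>B\<close> by \<open>B T\<close> removes \<open>Z\<close> from the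
  argument of \<open>f\<close> at the price of \<open>\<bar>det T\<bar>\<close> to the power \<open>2(m + n)\<close>, which is
  \<open>det (1 + Z Z\<^sup>\<dagger>)\<close> to the power \<open>-(m + n)\<close> (\<open>integral_square_block\<close>). What is left is the constant
  \<open>C\<close>, and since \<open>\<bar>det B\<bar>\<close> is homogeneous, \<open>C\<close> is a universal multiple of the moment of \<open>f\<close> that
  admissibility prescribes (\<open>universal_constant\<close>).

  The Jacobians come from invariance. A linear bijection multiplies Lebesgue measure by a constant,
  by the uniqueness of Haar measure (\<open>linear_bij_scales_volume\<close>), and this constant is multiplicative.
  It is computed directly for row scalings; it is 1 for shears, which are conjugate to their squares,
  and for isometries. Gram-Schmidt (\<open>gram_schmidt\<close>) writes every invertible matrix as a product of
  matrices of these kinds. Applied to the rows of \<open>[1 | Z]\<close> it also produces the matrix \<open>T\<close>.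
\<close>

section \<open>Linear bijections and Lebesgue measure\<close>

text \<open>The constant \<open>c\<close> is the Jacobian of the substitution \<open>y = L x\<close>. Source and target may be
  different spaces, which covers transposition and the splitting of a matrix into blocks.\<close>

definition scales_volume :: "('a::euclidean_space \<Rightarrow> 'b::euclidean_space) \<Rightarrow> real \<Rightarrow> bool" where
  "scales_volume L c \<longleftrightarrow> 0 < c \<and>
     (\<forall>g\<in>borel_measurable borel. (\<integral>\<^sup>+x. g x \<partial>lborel) = ennreal c * (\<integral>\<^sup>+x. g (L x) \<partial>lborel))"

lemma scales_volumeD:
  "scales_volume L c \<Longrightarrow> g \<in> borel_measurable borel \<Longrightarrow>
     (\<integral>\<^sup>+x. g x \<partial>lborel) = ennreal c * (\<integral>\<^sup>+x. g (L x) \<partial>lborel)"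
  by (simp add: scales_volume_def)

lemma scales_volume_pos: "scales_volume L c \<Longrightarrow> 0 < c"
  by (simp add: scales_volume_def)

lemma linear_borel_measurable:
  fixes L :: "'a::euclidean_space \<Rightarrow> 'b::euclidean_space"
  assumes "linear L"
  shows "L \<in> borel_measurable borel"
  using assms by (intro borel_measurable_continuous_onI linear_continuous_on)
    (simp add: linear_conv_bounded_linear)

lemma nn_integral_lborel_translation:
  fixes g :: "'a::euclidean_space \<Rightarrow> ennreal"
  assumes [measurable]: "g \<in> borel_measurable borel"
  shows "(\<integral>\<^sup>+x. g (x + a) \<partial>lborel) = (\<integral>\<^sup>+x. g x \<partial>lborel)"
proof -
  have "(\<integral>\<^sup>+x. g x \<partial>lborel) = (\<integral>\<^sup>+x. g x \<partial>distr lborel borel ((+) a))"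
    by (simp add: lborel_distr_plus)
  also have "\<dots> = (\<integral>\<^sup>+x. g (a + x) \<partial>lborel)"
    by (rule nn_integral_distr) auto
  finally show ?thesis
    by (simp add: add.commute)
qed

lemma emeasure_unit_ball_bounds:
  "0 < emeasure lborel (ball (0::'a::euclidean_space) 1)"
  "emeasure lborel (ball (0::'a::euclidean_space) 1) < \<infinity>"
  by (simp_all add: emeasure_ball)

text \<open>Uniqueness of Haar measure. Put \<open>w = indicator (ball 0 1)\<close>. By translation
  invariance the factor \<open>\<integral>w\<close> on the left may be written \<open>\<integral>w(s - L x) ds\<close>. In the resulting
  double integral of \<open>g(L x) w(s - L x)\<close> the shift \<open>x \<mapsto> x + L\<inverse> s\<close> moves \<open>s\<close> from \<open>w\<close> to \<open>g\<close>, by the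
  symmetry of the ball, and integrating over \<open>s\<close> first leaves \<open>\<integral>g\<close> times \<open>\<integral>w(L x) dx\<close>.\<close>

lemma linear_bij_integral:
  fixes L :: "'a::euclidean_space \<Rightarrow> 'b::euclidean_space" and g :: "'b \<Rightarrow> ennreal"
  assumes "linear L" "bij L" and [measurable]: "g \<in> borel_measurable borel"
  shows "(\<integral>\<^sup>+x. g (L x) \<partial>lborel) * emeasure lborel (ball (0::'b) 1) =
         (\<integral>\<^sup>+y. g y \<partial>lborel) * emeasure lborel (L -` ball 0 1)"
proof -
  have [measurable]: "L \<in> borel_measurable borel"
    using assms(1) by (rule linear_borel_measurable)
  have vimage_meas [measurable]: "L -` ball 0 1 \<in> sets borel"
    using measurable_sets_borel[of L borel "ball 0 1"] by simp
  define w :: "'b \<Rightarrow> ennreal" where "w = indicator (ball 0 1)"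
  have [measurable]: "w \<in> borel_measurable borel"
    by (simp add: w_def borel_measurable_indicator)
  have w_minus: "w (- y) = w y" for y
    by (simp add: w_def indicator_def)
  have w_int: "(\<integral>\<^sup>+s. w s \<partial>lborel) = emeasure lborel (ball (0::'b) 1)"
    by (simp add: w_def)
  have w_L: "(\<integral>\<^sup>+x. w (L x) \<partial>lborel) = emeasure lborel (L -` ball 0 1)"
  proof -
    have "(\<lambda>x. w (L x)) = indicator (L -` ball 0 1)"
      by (auto simp: w_def indicator_def)
    then show ?thesis by simp
  qed
  have "(\<integral>\<^sup>+x. g (L x) \<partial>lborel) * (\<integral>\<^sup>+s. w s \<partial>lborel) =
        (\<integral>\<^sup>+x. g (L x) * (\<integral>\<^sup>+s. w (s + (- L x)) \<partial>lborel) \<partial>lborel)"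
    by (simp add: nn_integral_lborel_translation nn_integral_multc del: add_uminus_conv_diff)
  also have "\<dots> = (\<integral>\<^sup>+x. (\<integral>\<^sup>+s. g (L x) * w (s - L x) \<partial>lborel) \<partial>lborel)"
    by (simp add: nn_integral_cmult)
  also have "\<dots> = (\<integral>\<^sup>+s. (\<integral>\<^sup>+x. g (L x) * w (s - L x) \<partial>lborel) \<partial>lborel)"
    by (rule lborel_pair.Fubini'[symmetric]) simp
  also have "\<dots> = (\<integral>\<^sup>+s. (\<integral>\<^sup>+x. g (L x + s) * w (L x) \<partial>lborel) \<partial>lborel)"
  proof (rule nn_integral_cong)
    fix s
    obtain a where a: "L a = s"
      using \<open>bij L\<close> by (metis bij_pointE)
    have "(\<integral>\<^sup>+x. g (L x) * w (s - L x) \<partial>lborel) =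
          (\<integral>\<^sup>+x. g (L (x + a)) * w (s - L (x + a)) \<partial>lborel)"
      by (rule nn_integral_lborel_translation[symmetric]) simp
    then show "(\<integral>\<^sup>+x. g (L x) * w (s - L x) \<partial>lborel) = (\<integral>\<^sup>+x. g (L x + s) * w (L x) \<partial>lborel)"
      using linear_add[OF \<open>linear L\<close>] w_minus by (simp add: a)
  qed
  also have "\<dots> = (\<integral>\<^sup>+x. (\<integral>\<^sup>+s. g (L x + s) * w (L x) \<partial>lborel) \<partial>lborel)"
    by (rule lborel_pair.Fubini') simp
  also have "\<dots> = (\<integral>\<^sup>+x. (\<integral>\<^sup>+s. g (s + L x) \<partial>lborel) * w (L x) \<partial>lborel)"
    by (simp add: nn_integral_multc add.commute)
  also have "\<dots> = (\<integral>\<^sup>+y. g y \<partial>lborel) * (\<integral>\<^sup>+x. w (L x) \<partial>lborel)"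
    by (simp add: nn_integral_lborel_translation nn_integral_cmult)
  finally show ?thesis
    by (simp add: w_int w_L)
qed

text \<open>The preimage of the unit ball is open, nonempty and bounded, so its volume can be
  divided out of the preceding identity.\<close>

lemma linear_bij_scales_volume:
  fixes L :: "'a::euclidean_space \<Rightarrow> 'b::euclidean_space"
  assumes "linear L" "bij L"
  shows "\<exists>c. scales_volume L c"
proof -
  define V where "V = emeasure lborel (L -` ball 0 1)"
  define W where "W = emeasure lborel (ball (0::'b) 1)"
  have W: "0 < W" "W < \<infinity>"
    unfolding W_def by (rule emeasure_unit_ball_bounds)+
  have lin: "bounded_linear L" 
    using assms(1) by (simp add: linear_conv_bounded_linear)
  have "inj L" using assms(2) by (simp add: bij_def)
  have op: "open (L -` ball 0 1)"
    using lin by (intro continuous_open_vimage linear_continuous_on ballI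
        continuous_on_interior linear_continuous_at) auto
  have ne: "L -` ball 0 1 \<noteq> {}"
    using linear_0[OF assms(1)] by (metis centre_in_ball empty_iff vimageI zero_less_one)
  obtain B where B: "B > 0" "\<And>x. B * norm x \<le> norm (L x)"
    using linear_inj_bounded_below_pos[OF assms(1) \<open>inj L\<close>] by metis
  have "norm x \<le> 1 / B" if "norm (L x) < 1" for x
    using B(1) B(2)[of x] that by (simp add: pos_le_divide_eq mult.commute)
  then have bd: "bounded (L -` ball 0 1)"
    by (intro boundedI[of _ "1 / B"]) auto
  have V: "0 < V" "V < \<infinity>"
  proof -
    show "V < \<infinity>"
      unfolding V_def using bd by (rule emeasure_bounded_finite)
    have "V \<noteq> 0"
    proof
      assume "V = 0"
      then have "negligible (L -` ball 0 1)"
        using op unfolding V_def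
        by (simp add: negligible_iff_null_sets null_sets_completionI null_sets_def)
      then show False
        using open_not_negligible[OF op ne] by simp
    qed
    then show "0 < V" by (simp add: zero_less_iff_neq_zero)
  qed
  have "scales_volume L (enn2real W / enn2real V)"
    unfolding scales_volume_def
  proof (intro conjI ballI)
    show "0 < enn2real W / enn2real V"
      using V W by (simp add: enn2real_positive_iff)
    fix g :: "'b \<Rightarrow> ennreal" assume g: "g \<in> borel_measurable borel"
    have *: "ennreal (enn2real W / enn2real V) = W / V"
      using V W by (simp add: divide_ennreal[symmetric] enn2real_positive_iff)
    have eq: "(\<integral>\<^sup>+x. g (L x) \<partial>lborel) * W = (\<integral>\<^sup>+y. g y \<partial>lborel) * V"
      unfolding V_def W_def by (rule linear_bij_integral[OF assms g])
    have "(\<integral>\<^sup>+y. g y \<partial>lborel) = (\<integral>\<^sup>+y. g y \<partial>lborel) * V / V"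
      using V by (simp add: ennreal_mult_divide_eq)
    also have "\<dots> = W / V * (\<integral>\<^sup>+x. g (L x) \<partial>lborel)"
      unfolding eq[symmetric] by (simp add: divide_ennreal_def mult_ac)
    finally show "(\<integral>\<^sup>+y. g y \<partial>lborel) = ennreal (enn2real W / enn2real V) * (\<integral>\<^sup>+x. g (L x) \<partial>lborel)"
      by (simp add: *)
  qed
  then show ?thesis ..
qed

lemma scales_volume_unique:
  fixes L :: "'a::euclidean_space \<Rightarrow> 'b::euclidean_space"
  assumes "scales_volume L c" "scales_volume L d"
  shows "c = d"
proof -
  define w :: "'b \<Rightarrow> ennreal" where "w = indicator (ball 0 1)"
  define v where "v = (\<integral>\<^sup>+x. w (L x) \<partial>lborel)"
  have w: "w \<in> borel_measurable borel" by (simp add: w_def borel_measurable_indicator)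
  have c: "emeasure lborel (ball (0::'b) 1) = ennreal c * v"
    using scales_volumeD[OF assms(1) w] by (simp add: v_def w_def)
  have d: "emeasure lborel (ball (0::'b) 1) = ennreal d * v"
    using scales_volumeD[OF assms(2) w] by (simp add: v_def w_def)
  have "v \<noteq> 0" "v \<noteq> \<infinity>"
    using emeasure_unit_ball_bounds[where 'a='b] c scales_volume_pos[OF assms(1)]
    by (auto simp: ennreal_mult_top)
  moreover have "v * ennreal c = v * ennreal d"
    using c d by (simp add: mult.commute)
  ultimately have "ennreal c = ennreal d"
    by (simp add: ennreal_mult_cancel_left)
  then show ?thesis
    using assms[THEN scales_volume_pos] by simp
qed

lemma scales_volume_compose:
  fixes L :: "'a::euclidean_space \<Rightarrow> 'b::euclidean_space"
    and M :: "'c::euclidean_space \<Rightarrow> 'a"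
  assumes "scales_volume L c" "scales_volume M d" "linear L"
  shows "scales_volume (\<lambda>x. L (M x)) (c * d)"
proof -
  have [measurable]: "L \<in> borel_measurable borel"
    using assms(3) by (rule linear_borel_measurable)
  have pos: "0 < c" "0 < d" using assms scales_volume_pos by auto
  show ?thesis
    unfolding scales_volume_def
  proof (intro conjI ballI)
    fix g :: "'b \<Rightarrow> ennreal" assume [measurable]: "g \<in> borel_measurable borel"
    have "(\<integral>\<^sup>+x. g x \<partial>lborel) = ennreal c * (\<integral>\<^sup>+x. g (L x) \<partial>lborel)"
      by (rule scales_volumeD[OF assms(1)]) simp
    also have "(\<integral>\<^sup>+x. g (L x) \<partial>lborel) = ennreal d * (\<integral>\<^sup>+x. g (L (M x)) \<partial>lborel)"
      by (rule scales_volumeD[OF assms(2)]) simp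
    finally show "(\<integral>\<^sup>+x. g x \<partial>lborel) = ennreal (c * d) * (\<integral>\<^sup>+x. g (L (M x)) \<partial>lborel)"
      using pos by (simp add: ennreal_mult mult.assoc)
  qed (use pos in simp)
qed

text \<open>An isometry pulls the unit ball back to the unit ball, and unit balls in spaces of the
  same dimension have the same volume.\<close>

lemma scales_volume_isometry:
  fixes L :: "'a::euclidean_space \<Rightarrow> 'b::euclidean_space"
  assumes "linear L" "surj L" and norm: "\<And>x. norm (L x) = norm x"
  shows "scales_volume L 1"
proof -
  have "inj L"
    using assms(1) norm by (metis linear_injective_0 norm_eq_zero)
  then have "bij L" using assms(2) by (simp add: bij_def)
  have dim: "DIM('a) = DIM('b)"
    using dim_image_eq[OF assms(1), of UNIV] \<open>inj L\<close> assms(2) by simp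
  have "L -` ball 0 1 = ball 0 1"
    using norm by auto
  then have eq: "emeasure lborel (L -` ball 0 1) = emeasure lborel (ball (0::'b) 1)"
    by (simp add: emeasure_ball dim)
  have "(\<integral>\<^sup>+x. g x \<partial>lborel) = (\<integral>\<^sup>+x. g (L x) \<partial>lborel)" if g: "g \<in> borel_measurable borel" for g
  proof -
    let ?W = "emeasure lborel (ball (0::'b) 1)"
    have "?W * (\<integral>\<^sup>+x. g x \<partial>lborel) = ?W * (\<integral>\<^sup>+x. g (L x) \<partial>lborel)"
      using linear_bij_integral[OF assms(1) \<open>bij L\<close> g] unfolding eq by (simp only: mult.commute)
    moreover have "?W \<noteq> 0" "?W \<noteq> top"
      using emeasure_unit_ball_bounds[where 'a='b] by auto
    ultimately show ?thesis by (simp add: ennreal_mult_cancel_left del: emeasure_lborel_ball_finite)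
  qed
  then show ?thesis by (simp add: scales_volume_def)
qed

section \<open>Jacobians of elementary and unitary matrices\<close>

lemma det_nonzero_inverse:
  fixes B :: "'a::field^'m^'m"
  assumes "det B \<noteq> 0"
  obtains B' where "B ** B' = mat 1" "B' ** B = mat 1"
  using assms invertible_det_nz[of B] unfolding invertible_def by blast

lemma det_nonzero_if_right_inverse:
  fixes B :: "'a::field^'m^'m"
  assumes "B ** B' = mat 1"
  shows "det B \<noteq> 0"
  using assms invertible_det_nz[of B] matrix_left_right_inverse unfolding invertible_def by blast

lemma linear_left_mult: "linear (\<lambda>X::complex^'n^'m. (B::complex^'m^'p) ** X)"
  by (rule linearI)
    (simp_all add: vec_eq_iff matrix_matrix_mult_def scaleR_sum_right sum.distrib distrib_left)

lemma bij_left_mult: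
  assumes "det (B::complex^'m^'m) \<noteq> 0"
  shows "bij (\<lambda>X::complex^'n^'m. B ** X)"
proof -
  obtain B' where "B ** B' = mat 1" "B' ** B = mat 1"
    using assms by (rule det_nonzero_inverse)
  then show ?thesis
    by (intro bij_betw_byWitness[of _ "\<lambda>X. B' ** X"]) (auto simp: matrix_mul_assoc)
qed

lemma conj_transpose_mult: "conj_transpose (A ** B) = conj_transpose B ** conj_transpose A"
  by (simp add: vec_eq_iff conj_transpose_def matrix_matrix_mult_def mult.commute)

lemma conj_transpose_mat_1 [simp]: "conj_transpose (mat 1) = mat 1"
  by (simp add: vec_eq_iff conj_transpose_def mat_def)

lemma det_conj_transpose: "det (conj_transpose A) = cnj (det A)"
proof -
  have "cnj (det A) = det (transpose (conj_transpose A))"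
    unfolding det_def by (simp add: conj_transpose_def transpose_def)
  then show ?thesis by (simp add: det_transpose)
qed

lemma tr_sq_eq_norm: "tr_sq A = (norm A)\<^sup>2"
  unfolding tr_sq_def trace_conj_transpose
  by (simp add: norm_vec_def L2_set_def real_sqrt_pow2 sum_nonneg)

lemma tr_sq_unitary_left:
  assumes "conj_transpose U ** U = mat 1"
  shows "tr_sq (U ** X) = tr_sq X"
proof -
  have "trace ((U ** X) ** conj_transpose (U ** X)) = trace (U ** (X ** conj_transpose X ** conj_transpose U))"
    by (simp add: conj_transpose_mult matrix_mul_assoc)
  also have "\<dots> = trace (X ** conj_transpose X ** (conj_transpose U ** U))"
    by (subst trace_mul_sym) (simp add: matrix_mul_assoc)
  finally show ?thesis by (simp add: tr_sq_def assms)
qed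

text \<open>The change of variables \<open>Y = B X\<close> on complex \<open>m\<times>n\<close> matrices acts on each of the \<open>n\<close>
  columns by \<open>B\<close>, whose real Jacobian is \<open>\<bar>det B\<bar>\<^sup>2\<close>. The type argument is there because \<open>n\<close> does
  not occur in the type of \<open>B\<close>.\<close>

definition det_scales :: "'n::finite itself \<Rightarrow> complex^'m^'m \<Rightarrow> bool" where
  "det_scales _ B \<longleftrightarrow> det B \<noteq> 0 \<and>
     scales_volume (\<lambda>X::complex^'n^'m. B ** X) (cmod (det B) ^ (2 * CARD('n)))"

lemma det_scales_mult:
  fixes B B' :: "complex^'m^'m"
  assumes "det_scales TYPE('n::finite) B" "det_scales TYPE('n) B'"
  shows "det_scales TYPE('n) (B ** B')"
proof -
  have "scales_volume (\<lambda>X::complex^'n^'m. B ** (B' ** X))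
     (cmod (det B) ^ (2 * CARD('n)) * cmod (det B') ^ (2 * CARD('n)))"
    using assms unfolding det_scales_def by (intro scales_volume_compose linear_left_mult) auto
  then show ?thesis
    using assms unfolding det_scales_def
    by (simp add: det_mul matrix_mul_assoc norm_mult power_mult_distrib)
qed

text \<open>Both the Jacobian and \<open>\<bar>det\<bar>\<close> are multiplicative and the Jacobian is unique, so the
  formula for \<open>T\<close> and \<open>T B\<close> determines it for \<open>B\<close>.\<close>

lemma det_scales_cancel:
  fixes T B :: "complex^'m^'m"
  assumes "det_scales TYPE('n::finite) T" "det_scales TYPE('n) (T ** B)"
  shows "det_scales TYPE('n) B"
proof -
  have B: "det B \<noteq> 0"
    using assms(2) by (auto simp: det_scales_def det_mul)
  obtain c where c: "scales_volume (\<lambda>X::complex^'n^'m. B ** X) c"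
    using linear_bij_scales_volume[OF linear_left_mult bij_left_mult[OF B]] by blast
  let ?N = "2 * CARD('n)"
  have "scales_volume (\<lambda>X::complex^'n^'m. T ** (B ** X)) (cmod (det T) ^ ?N * c)"
    using assms c unfolding det_scales_def by (intro scales_volume_compose linear_left_mult) auto
  then have "scales_volume (\<lambda>X::complex^'n^'m. (T ** B) ** X) (cmod (det T) ^ ?N * c)"
    by (simp add: matrix_mul_assoc)
  then have "cmod (det T) ^ ?N * c = cmod (det (T ** B)) ^ ?N"
    using assms(2) unfolding det_scales_def by (blast intro: scales_volume_unique)
  moreover have "det T \<noteq> 0"
    using assms(1) by (simp add: det_scales_def)
  ultimately have "c = cmod (det B) ^ ?N"
    by (simp add: det_mul norm_mult power_mult_distrib)
  then show ?thesis
    using B c by (simp add: det_scales_def)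
qed

text \<open>Left multiplication by a unitary matrix is an isometry and its determinant has modulus 1.\<close>

lemma det_scales_unitary:
  fixes U :: "complex^'m^'m"
  assumes U: "U ** conj_transpose U = mat 1"
  shows "det_scales TYPE('n::finite) U"
proof -
  have U': "conj_transpose U ** U = mat 1"
    using U by (simp add: matrix_left_right_inverse)
  have "det U * cnj (det U) = 1"
    using arg_cong[OF U, of det] by (simp add: det_mul det_conj_transpose)
  then have "(cmod (det U))\<^sup>2 = 1"
    by (metis complex_norm_square of_real_eq_1_iff)
  then have one: "cmod (det U) = 1"
    using power2_eq_1_iff[of "cmod (det U)"] norm_ge_zero[of "det U"] by linarith
  then have nz: "det U \<noteq> 0" by auto
  have "norm (U ** X) = norm X" for X :: "complex^'n^'m"
    using tr_sq_unitary_left[OF U', of X] by (simp add: tr_sq_eq_norm)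
  then have "scales_volume (\<lambda>X::complex^'n^'m. U ** X) 1"
    using bij_left_mult[OF nz] by (intro scales_volume_isometry linear_left_mult) (auto simp: bij_def)
  then show ?thesis
    using nz by (simp add: det_scales_def one)
qed

text \<open>The shear acts on all rows \<open>i \<noteq> k\<close> at once, so that one shear and one scaling make up a
  whole step of the Gram-Schmidt process.\<close>

definition row_scaling :: "'m \<Rightarrow> real \<Rightarrow> complex^'m^'m" where
  "row_scaling k s = (\<chi> i j. if i = j then (if i = k then of_real s else 1) else 0)"

definition row_shear :: "'m \<Rightarrow> ('m \<Rightarrow> complex) \<Rightarrow> complex^'m^'m" where
  "row_shear k t = (\<chi> i j. if i = j then 1 else if j = k then t i else 0)"

lemma row_scaling_mult:
  "(row_scaling k s ** X) $ i $ j = (if i = k then of_real s * X $ i $ j else X $ i $ j)"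
  by (simp add: matrix_matrix_mult_def row_scaling_def if_distrib[where f="\<lambda>x. x * _"] cong: if_cong)

lemma row_shear_mult:
  "(row_shear k t ** X) $ i $ j = X $ i $ j + (if i = k then 0 else t i * X $ k $ j)"
proof -
  have "(row_shear k t ** X) $ i $ j =
    (\<Sum>l\<in>UNIV. (if i = l then X $ l $ j else 0) + (if l = k then (if i = k then 0 else t i * X $ l $ j) else 0))"
    unfolding matrix_matrix_mult_def row_shear_def by (simp, intro sum.cong) auto
  then show ?thesis by (simp add: sum.distrib)
qed

lemma det_row_scaling: "det (row_scaling k s) = of_real s"
  by (subst det_diagonal) (simp_all add: row_scaling_def)

lemma diagonal_scales_volume:
  fixes c :: "'a::euclidean_space \<Rightarrow> real"
  assumes c: "\<And>b. b \<in> Basis \<Longrightarrow> 0 < c b"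
    and L: "\<And>x b. b \<in> Basis \<Longrightarrow> L x \<bullet> b = c b * (x \<bullet> b)"
  shows "scales_volume L (\<Prod>b\<in>Basis. c b)"
proof -
  have L_eq: "L = (\<lambda>x. 0 + (\<Sum>j\<in>Basis. (c j * (x \<bullet> j)) *\<^sub>R j))"
  proof
    fix x
    have "L x = (\<Sum>j\<in>Basis. (L x \<bullet> j) *\<^sub>R j)"
      by (rule euclidean_representation[symmetric])
    also have "\<dots> = (\<Sum>j\<in>Basis. (c j * (x \<bullet> j)) *\<^sub>R j)"
      by (rule sum.cong) (simp_all add: L)
    finally show "L x = 0 + (\<Sum>j\<in>Basis. (c j * (x \<bullet> j)) *\<^sub>R j)" by simp
  qed
  have [measurable]: "L \<in> borel_measurable borel"
    unfolding L_eq by measurable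
  have "c b \<noteq> 0" if "b \<in> Basis" for b
    using c[OF that] by simp
  then have "lborel = density (distr lborel borel L) (\<lambda>_. (\<Prod>j\<in>Basis. \<bar>c j\<bar>))"
    unfolding L_eq by (rule lborel_affine_euclidean)
  also have "(\<Prod>j\<in>Basis. \<bar>c j\<bar>) = (\<Prod>j\<in>Basis. c j)"
    by (rule prod.cong) (simp_all add: c less_imp_le)
  finally have eq: "lborel = density (distr lborel borel L) (\<lambda>_. ennreal (\<Prod>j\<in>Basis. c j))" .
  show ?thesis
    unfolding scales_volume_def
  proof (intro conjI ballI)
    show "0 < (\<Prod>b\<in>Basis. c b)" using c by (simp add: prod_pos)
    fix g :: "'a \<Rightarrow> ennreal" assume [measurable]: "g \<in> borel_measurable borel"
    show "(\<integral>\<^sup>+x. g x \<partial>lborel) = ennreal (\<Prod>b\<in>Basis. c b) * (\<integral>\<^sup>+x. g (L x) \<partial>lborel)"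
      by (subst (1) eq) (simp add: nn_integral_density nn_integral_distr nn_integral_cmult)
  qed
qed

text \<open>The standard basis of the matrix space consists of the basis vectors of the \<open>m\<close> row spaces, each of
  real dimension \<open>2n\<close>; exactly those of row \<open>k\<close> are multiplied by \<open>s\<close>.\<close>

lemma det_scales_row_scaling:
  assumes "0 < s"
  shows "det_scales TYPE('n::finite) (row_scaling (k::'m::finite) s)"
proof -
  define c :: "complex^'n^'m \<Rightarrow> real" where "c b = (if b $ k = 0 then 1 else s)" for b
  have basis: "(Basis :: (complex^'n^'m) set) = (\<lambda>(i, u). axis i u) ` (UNIV \<times> Basis)"
    by (auto simp: Basis_vec_def[where 'a="complex^'n"])
  have inj: "inj_on (\<lambda>(i, u::complex^'n). axis (i::'m) u) (UNIV \<times> Basis)"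
    by (auto simp: inj_on_def axis_eq_axis)
  have "(\<Prod>b\<in>Basis. c b) = (\<Prod>(i, u)\<in>UNIV \<times> (Basis :: (complex^'n) set). c (axis i u))"
    unfolding basis by (subst prod.reindex[OF inj]) (simp add: case_prod_unfold)
  also have "\<dots> = (\<Prod>i\<in>UNIV. \<Prod>u\<in>(Basis :: (complex^'n) set). c (axis i u))"
    by (simp add: prod.cartesian_product)
  also have "\<dots> = (\<Prod>i\<in>UNIV. if i = k then s ^ DIM(complex^'n) else 1)"
  proof (rule prod.cong)
    fix i :: 'm
    have "c (axis i u) = (if i = k then s else 1)" if "u \<in> (Basis :: (complex^'n) set)" for u
      using that by (auto simp: c_def axis_def)
    then show "(\<Prod>u\<in>(Basis :: (complex^'n) set). c (axis i u)) = (if i = k then s ^ DIM(complex^'n) else 1)"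
      by simp
  qed simp
  finally have prod: "(\<Prod>b\<in>Basis. c b) = s ^ (2 * CARD('n))"
    by (simp add: mult.commute)
  have "scales_volume (\<lambda>X::complex^'n^'m. row_scaling k s ** X) (\<Prod>b\<in>Basis. c b)"
  proof (rule diagonal_scales_volume)
    fix X b :: "complex^'n^'m" assume "b \<in> Basis"
    then obtain i u where b: "b = axis i u" "u \<in> Basis"
      by (auto simp: Basis_vec_def[where 'a="complex^'n"])
    have row: "(row_scaling k s ** X) $ i = (if i = k then s else 1) *\<^sub>R (X $ i)"
      by (rule vec_eq_iff[THEN iffD2])
        (simp add: row_scaling_mult, simp add: scaleR_conv_of_real)
    have "c b = (if i = k then s else 1)"
      using b by (auto simp: c_def axis_def)
    then show "(row_scaling k s ** X) \<bullet> b = c b * (X \<bullet> b)"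
      using b row by (simp add: inner_axis)
  qed (use assms in \<open>simp add: c_def\<close>)
  then show ?thesis
    using assms by (simp add: det_scales_def det_row_scaling prod)
qed

text \<open>Doubling row \<open>k\<close> conjugates a shear \<open>S\<close> into its square: \<open>E S\<^sup>2 = S E\<close>. A multiplicative
  function with nonzero values in a field is therefore 1 at \<open>S\<close>; this applies to the determinant and
  to the Jacobian.\<close>

lemma det_scales_row_shear: "det_scales TYPE('n::finite) (row_shear (k::'m::finite) t)"
proof -
  let ?S = "row_shear k t" and ?E = "row_scaling k 2"
  \<comment> \<open>Off the diagonal both sides have \<open>2 t i\<close> in column \<open>k\<close>; the entry at \<open>(k, k)\<close> is 2.\<close>
  have conj: "?E ** (?S ** ?S) = ?S ** ?E"
  proof -
    have "(?E ** (?S ** ?S)) $ i $ j = (?S ** ?E) $ i $ j" for i j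
      unfolding row_scaling_mult row_shear_mult
      by (auto simp: row_shear_def row_scaling_def)
    then show ?thesis by (simp add: vec_eq_iff)
  qed
  have "?S ** row_shear k (\<lambda>i. - t i) = mat 1"
    unfolding vec_eq_iff row_shear_mult by (auto simp: row_shear_def mat_def)
  then have nz: "det ?S \<noteq> 0"
    by (rule det_nonzero_if_right_inverse)
  have "det ?E * (det ?S * det ?S) = det ?S * det ?E"
    using arg_cong[OF conj, of det] by (simp only: det_mul)
  then have det: "det ?S = 1"
    using nz by (simp add: det_row_scaling)
  obtain c where c: "scales_volume (\<lambda>X::complex^'n^'m. ?S ** X) c"
    using linear_bij_scales_volume[OF linear_left_mult bij_left_mult[OF nz]] by blast
  have "det_scales TYPE('n) ?E" by (rule det_scales_row_scaling) simp
  then obtain d where d: "scales_volume (\<lambda>X::complex^'n^'m. ?E ** X) d"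
    by (auto simp: det_scales_def)
  have "scales_volume (\<lambda>X::complex^'n^'m. ?E ** (?S ** (?S ** X))) (d * (c * c))"
    by (intro scales_volume_compose c d linear_left_mult)
  then have "scales_volume (\<lambda>X::complex^'n^'m. ?S ** (?E ** X)) (d * (c * c))"
    using conj by (simp add: matrix_mul_assoc)
  moreover have "scales_volume (\<lambda>X::complex^'n^'m. ?S ** (?E ** X)) (c * d)"
    by (intro scales_volume_compose c d linear_left_mult)
  ultimately have "d * (c * c) = c * d"
    by (rule scales_volume_unique)
  then have "c = 1"
    using c[THEN scales_volume_pos] d[THEN scales_volume_pos] by simp
  then show ?thesis
    using c det by (simp add: det_scales_def)
qed

section \<open>Gram-Schmidt and the Jacobian of an invertible matrix\<close>

abbreviation gram :: "complex^'p^'m \<Rightarrow> complex^'m^'m" where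
  "gram W \<equiv> W ** conj_transpose W"

lemma gram_entry: "gram W $ i $ j = (\<Sum>a\<in>UNIV. W $ i $ a * cnj (W $ j $ a))"
  by (simp add: matrix_matrix_mult_def conj_transpose_def)

lemma gram_cnj: "cnj (gram W $ i $ j) = gram W $ j $ i"
  by (simp add: gram_entry mult.commute)

text \<open>Subtracting multiples of row \<open>k\<close> makes all other rows orthogonal to it, and a scaling makes
  it a unit vector. A row in \<open>S\<close> is already orthogonal to row \<open>k\<close>, so its coefficient is zero and it
  stays as it is; its inner products with the other rows also stay, as these change only by multiples
  of row \<open>k\<close>. Only one shear and one scaling are used, hence the Jacobian is known.\<close>

lemma gram_schmidt_step:
  fixes W :: "complex^'p^'m"
  assumes row: "W $ k \<noteq> 0" and k: "k \<notin> S"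
    and S: "\<And>i j. i \<in> S \<Longrightarrow> gram W $ i $ j = mat 1 $ i $ j"
  shows "\<exists>T. det_scales TYPE('n::finite) T \<and>
    (\<forall>i\<in>insert k S. \<forall>j. gram (T ** W) $ i $ j = mat 1 $ i $ j)"
proof -
  define g where "g = (norm (W $ k))\<^sup>2"
  have g: "0 < g" using row by (simp add: g_def)
  have Gkk: "gram W $ k $ k = of_real g"
    unfolding g_def gram_entry
    by (simp add: norm_vec_def L2_set_def sum_nonneg complex_norm_square del: of_real_power)
  define u where "u i = (if i = k then 0 else - (gram W $ i $ k) / of_real g)" for i
  define W1 where "W1 = row_shear k u ** W"
  have W1: "W1 $ i $ a = W $ i $ a + u i * W $ k $ a" for i a
    unfolding W1_def row_shear_mult by (simp add: u_def)
  have G1: "gram W1 $ i $ j =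
      gram W $ i $ j + u i * gram W $ k $ j + cnj (u j) * gram W $ i $ k + u i * cnj (u j) * gram W $ k $ k" for i j
    unfolding gram_entry W1
    by (simp add: sum.distrib sum_distrib_left distrib_left distrib_right mult_ac add_ac)
  have G1k: "gram W1 $ i $ k = (if i = k then of_real g else 0)" for i
    using g unfolding G1 Gkk by (simp add: u_def Gkk)
  have G1S: "gram W1 $ i $ j = mat 1 $ i $ j" if "i \<in> S" for i j
  proof -
    have "gram W $ i $ k = 0"
      using S[OF that, of k] k that by (auto simp: mat_def)
    then show ?thesis
      unfolding G1 by (simp add: u_def S[OF that])
  qed
  define s where "s = 1 / sqrt g"
  define T where "T = row_scaling k s ** row_shear k u"
  have TW: "(T ** W) $ i $ a = (if i = k then of_real s else 1) * W1 $ i $ a" for i a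
    unfolding T_def matrix_mul_assoc[symmetric] W1_def[symmetric] row_scaling_mult by simp
  have G2: "gram (T ** W) $ i $ j =
      (if i = k then of_real s else 1) * (if j = k then of_real s else 1) * gram W1 $ i $ j" for i j
    unfolding gram_entry TW by (simp add: sum_distrib_left mult_ac)
  have "of_real s * of_real s * of_real g = (1::complex)"
    using g by (simp add: s_def flip: of_real_mult)
  then have row_k: "gram (T ** W) $ k $ j = mat 1 $ k $ j" for j
    using G1k[of j] gram_cnj[of W1 j k] unfolding G2 by (auto simp: mat_def)
  have row_S: "gram (T ** W) $ i $ j = mat 1 $ i $ j" if "i \<in> S" for i j
    using G1S[OF that, of j] k that unfolding G2 by (auto simp: mat_def)
  have "det_scales TYPE('n) T"
    unfolding T_def using g
    by (intro det_scales_mult det_scales_row_scaling det_scales_row_shear) (simp add: s_def)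
  then show ?thesis
    using row_k row_S by (intro exI[of _ T]) auto
qed

lemma det_scales_mat_1: "det_scales TYPE('n::finite) (mat 1 :: complex^'m^'m)"
  by (rule det_scales_unitary) simp

lemma independent_rows_left_mult:
  fixes W :: "complex^'p^'m" and T :: "complex^'m^'m"
  assumes "\<And>v. v v* W = 0 \<Longrightarrow> v = 0" "det T \<noteq> 0" "v v* (T ** W) = 0"
  shows "v = 0"
proof -
  obtain T' where "T ** T' = mat 1" "T' ** T = mat 1"
    using assms(2) by (rule det_nonzero_inverse)
  then have "v = (v v* T) v* T'"
    by (simp add: vector_matrix_mul_assoc)
  moreover have "v v* T = 0"
    using assms(1)[of "v v* T"] assms(3) by (simp add: vector_matrix_mul_assoc)
  ultimately show "v = 0" by simp
qed

lemma independent_rows_nonzero: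
  fixes W :: "complex^'p^'m"
  assumes "\<And>v. v v* W = 0 \<Longrightarrow> v = 0"
  shows "W $ k \<noteq> 0"
proof
  assume "W $ k = 0"
  then have "axis k 1 v* W = 0"
    unfolding vec_eq_iff vector_matrix_mult_def by (auto simp: axis_def intro!: sum.neutral)
  then have "axis k 1 = (0 :: complex^'m)" by (rule assms)
  then show False by simp
qed

text \<open>Orthonormalisation of linearly independent rows by a transformation whose Jacobian is
  known. It serves twice: for a square matrix it reduces the Jacobian to that of a unitary matrix, and
  for \<open>[1 | Z]\<close> it removes the matrix \<open>1 + Z Z\<^sup>\<dagger>\<close> from the integral.\<close>

lemma gram_schmidt:
  fixes W :: "complex^'p^'m"
  assumes ind: "\<And>v. v v* W = 0 \<Longrightarrow> v = 0"
  obtains T where "det_scales TYPE('n::finite) T" "gram (T ** W) = mat 1"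
proof -
  have "\<exists>T. det_scales TYPE('n) T \<and> (\<forall>i\<in>S. \<forall>j. gram (T ** W) $ i $ j = mat 1 $ i $ j)" for S
    using finite[of S]
  proof (induction S rule: finite_induct)
    case empty
    show ?case using det_scales_mat_1 by blast
  next
    case (insert k S)
    then obtain T where T: "det_scales TYPE('n) T"
      "\<And>i j. i \<in> S \<Longrightarrow> gram (T ** W) $ i $ j = mat 1 $ i $ j" by blast
    have "det T \<noteq> 0" using T(1) by (simp add: det_scales_def)
    then have "(T ** W) $ k \<noteq> 0"
      by (intro independent_rows_nonzero independent_rows_left_mult[OF ind])
    from gram_schmidt_step[OF this insert.hyps(2) T(2)]
    obtain T' where "det_scales TYPE('n) T'"
      "\<forall>i\<in>insert k S. \<forall>j. gram (T' ** (T ** W)) $ i $ j = mat 1 $ i $ j" by blast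
    then show ?case
      using det_scales_mult[OF _ T(1), of T'] by (intro exI[of _ "T' ** T"]) (simp add: matrix_mul_assoc)
  qed
  from this[of UNIV] show ?thesis
    using that by (auto simp: vec_eq_iff)
qed

text \<open>The rows of \<open>B\<close> are independent, so \<open>T B\<close> is unitary for some product \<open>T\<close> of
  shears and scalings.\<close>

lemma det_nonzero_scales_volume_left:
  fixes B :: "complex^'m^'m"
  assumes "det B \<noteq> 0"
  shows "scales_volume (\<lambda>X::complex^'n^'m. B ** X) (cmod (det B) ^ (2 * CARD('n)))"
proof -
  have ind: "v = 0" if "v v* B = 0" for v
    using independent_rows_left_mult[of "mat 1" B v] assms that by simp
  obtain T where T: "det_scales TYPE('n) T" "gram (T ** B) = mat 1"
    using gram_schmidt[OF ind] by metis
  have "det_scales TYPE('n) B"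
    by (rule det_scales_cancel[OF T(1)], rule det_scales_unitary, rule T(2))
  then show ?thesis by (simp add: det_scales_def)
qed

lemma scales_volume_transpose:
  "scales_volume (transpose :: complex^'n^'m \<Rightarrow> complex^'m^'n) 1"
proof (rule scales_volume_isometry)
  show "linear (transpose :: complex^'n^'m \<Rightarrow> complex^'m^'n)"
    by (rule linearI) (simp_all add: vec_eq_iff transpose_def)
  show "surj (transpose :: complex^'n^'m \<Rightarrow> complex^'m^'n)"
    by (metis surjI transpose_transpose)
  fix X :: "complex^'n^'m"
  have "(norm (transpose X))\<^sup>2 = (norm X)\<^sup>2"
    unfolding tr_sq_eq_norm[symmetric] tr_sq_def trace_conj_transpose
    by (simp add: transpose_def) (rule sum.swap)
  then show "norm (transpose X) = norm X" by simp
qed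

text \<open>Right multiplication is left multiplication by the transpose, conjugated by the
  isometry \<open>X \<mapsto> X\<^sup>T\<close>.\<close>

lemma det_nonzero_scales_volume_right:
  fixes T :: "complex^'m^'m"
  assumes "det T \<noteq> 0"
  shows "scales_volume (\<lambda>X::complex^'m^'n. X ** T) (cmod (det T) ^ (2 * CARD('n)))"
proof -
  have "scales_volume (\<lambda>Y::complex^'n^'m. transpose T ** Y) (cmod (det (transpose T)) ^ (2 * CARD('n)))"
    using assms by (intro det_nonzero_scales_volume_left) (simp add: det_transpose)
  then have left: "scales_volume (\<lambda>Y::complex^'n^'m. transpose T ** Y) (cmod (det T) ^ (2 * CARD('n)))"
    by (simp only: det_transpose)
  have tr: "linear (transpose :: complex^'n^'m \<Rightarrow> complex^'m^'n)"
    by (rule linearI) (simp_all add: vec_eq_iff transpose_def)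
  have "scales_volume (\<lambda>X::complex^'m^'n. transpose (transpose T ** transpose X))
      (1 * (cmod (det T) ^ (2 * CARD('n)) * 1))"
    by (intro scales_volume_compose scales_volume_transpose left linear_left_mult tr)
  then show ?thesis
    by (simp add: matrix_transpose_mul)
qed

section \<open>Singular matrices form a null set\<close>

lemma continuous_on_matrix_mult [continuous_intros]:
  fixes f :: "'a::topological_space \<Rightarrow> complex^'m^'p" and g :: "'a \<Rightarrow> complex^'n^'m"
  assumes "continuous_on S f" "continuous_on S g"
  shows "continuous_on S (\<lambda>x. f x ** g x)"
  unfolding matrix_matrix_mult_def by (intro continuous_intros assms)

lemma continuous_on_det_complex [continuous_intros]:
  fixes f :: "'a::topological_space \<Rightarrow> complex^'m^'m"
  assumes "continuous_on S f"
  shows "continuous_on S (\<lambda>x. det (f x))"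
  unfolding det_def by (intro continuous_intros assms)

lemma borel_measurable_matrix_mult [measurable (raw)]:
  fixes f :: "'a \<Rightarrow> complex^'m^'p" and g :: "'a \<Rightarrow> complex^'n^'m"
  assumes "f \<in> borel_measurable M" "g \<in> borel_measurable M"
  shows "(\<lambda>x. f x ** g x) \<in> borel_measurable M"
  by (rule borel_measurable_continuous_Pair[OF assms]) (intro continuous_intros)

lemma borel_measurable_det [measurable (raw)]:
  fixes f :: "'a \<Rightarrow> complex^'m^'m"
  assumes "f \<in> borel_measurable M"
  shows "(\<lambda>x. det (f x)) \<in> borel_measurable M"
  by (rule borel_measurable_continuous_on[OF _ assms]) (intro continuous_intros)

lemma borel_measurable_tr_sq [measurable (raw)]:
  assumes "f \<in> borel_measurable M"
  shows "(\<lambda>x. tr_sq (f x)) \<in> borel_measurable M"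
  using assms unfolding tr_sq_eq_norm by measurable

lemma poly_det: "poly (det M) z = det (\<chi> i j. poly (M $ i $ j) z)" for M :: "complex poly^'m^'m"
proof -
  have "poly (of_int (sign p)) z = of_int (sign p)" for p :: "'m \<Rightarrow> 'm"
    by (cases p rule: sign_cases) auto
  then show ?thesis
    unfolding det_def by (simp add: poly_sum poly_prod)
qed

lemma det_scale: "det (\<chi> i j. z * A $ i $ j) = z ^ CARD('m) * det A" for A :: "complex^'m^'m"
  using det_rows_mul[of "\<lambda>_. z" "\<lambda>i. A $ i"] by (simp add: vector_scalar_mult_def)

text \<open>For \<open>c \<noteq> 0\<close> one has \<open>det (B + c 1) = c\<^sup>m det (1 + c\<inverse> B)\<close>. The polynomial \<open>det (1 + z B)\<close> is
  used because it is visibly nonzero: its value at \<open>z = 0\<close> is 1.\<close>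

lemma finite_singular_shifts:
  fixes B :: "complex^'m^'m"
  shows "finite {c::real. det (B + c *\<^sub>R mat 1) = 0}"
proof -
  define p where "p = det (\<chi> i j. [:mat 1 $ i $ j, B $ i $ j:] :: complex poly^'m^'m)"
  have p: "poly p z = det (\<chi> i j. mat 1 $ i $ j + z * B $ i $ j)" for z
    unfolding p_def poly_det by simp
  have "(\<chi> i j. mat 1 $ i $ j + 0 * B $ i $ j) = mat 1"
    by (simp add: vec_eq_iff)
  then have "poly p 0 = 1" unfolding p by simp
  then have "p \<noteq> 0" by auto
  then have "finite {z. poly p z = 0}" by (rule poly_roots_finite)
  moreover have "inj (\<lambda>c::real. inverse (of_real c) :: complex)"
    by (auto intro: injI)
  ultimately have "finite ((\<lambda>c::real. inverse (of_real c)) -` {z. poly p z = 0})"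
    by (rule finite_vimageI)
  moreover have "{c::real. det (B + c *\<^sub>R mat 1) = 0} \<subseteq>
      insert 0 ((\<lambda>c::real. inverse (of_real c)) -` {z. poly p z = 0})"
  proof
    fix c :: real assume "c \<in> {c. det (B + c *\<^sub>R mat 1) = 0}"
    then have c: "det (B + c *\<^sub>R mat 1) = 0" by simp
    have "poly p (inverse (of_real c)) = 0" if "c \<noteq> 0"
    proof -
      have "B + c *\<^sub>R mat 1 =
          (\<chi> i j. of_real c * (\<chi> i j. mat 1 $ i $ j + inverse (of_real c) * B $ i $ j) $ i $ j)"
        using that by (simp add: vec_eq_iff mat_def distrib_left, simp add: scaleR_conv_of_real)
      then have "det (B + c *\<^sub>R mat 1) = of_real c ^ CARD('m) * poly p (inverse (of_real c))"
        unfolding p by (simp only: det_scale)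
      then show ?thesis
        using c that by simp
    qed
    then show "c \<in> insert 0 ((\<lambda>c::real. inverse (of_real c)) -` {z. poly p z = 0})"
      by auto
  qed
  ultimately show ?thesis
    by (meson finite_insert finite_subset)
qed

text \<open>By translation invariance the singular matrices have the same measure as their shifts by
  multiples \<open>c\<close> of the identity. Averaging over \<open>c\<close> in the unit interval and exchanging the integrals
  gives zero, since each line in the direction of the identity contains only finitely many singular
  matrices.\<close>

lemma AE_det_nonzero: "AE B in lborel. det (B :: complex^'m^'m) \<noteq> 0"
proof -
  define w :: "complex^'m^'m \<Rightarrow> ennreal" where "w = indicator {B. det B = 0}"
  have meas: "{B :: complex^'m^'m. det B = 0} \<in> sets borel" by measurable
  then have [measurable]: "w \<in> borel_measurable borel"
    by (simp add: w_def borel_measurable_indicator)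
  have "(\<integral>\<^sup>+B. w B \<partial>lborel) = (\<integral>\<^sup>+B. w B \<partial>lborel) * (\<integral>\<^sup>+c. indicator {0..1::real} c \<partial>lborel)"
    by simp
  also have "\<dots> = (\<integral>\<^sup>+c. (\<integral>\<^sup>+B. w B \<partial>lborel) * indicator {0..1::real} c \<partial>lborel)"
    by (simp add: nn_integral_cmult)
  also have "\<dots> = (\<integral>\<^sup>+c. (\<integral>\<^sup>+B. w (B + c *\<^sub>R mat 1) * indicator {0..1::real} c \<partial>lborel) \<partial>lborel)"
    by (simp add: nn_integral_multc nn_integral_lborel_translation)
  also have "\<dots> = (\<integral>\<^sup>+B. (\<integral>\<^sup>+c. w (B + c *\<^sub>R mat 1) * indicator {0..1::real} c \<partial>lborel) \<partial>lborel)"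
    by (rule lborel_pair.Fubini') measurable
  also have "\<dots> = (\<integral>\<^sup>+(B :: complex^'m^'m). 0 \<partial>lborel)"
  proof (rule nn_integral_cong)
    fix B :: "complex^'m^'m"
    have "AE c in lborel. c \<notin> {c::real. det (B + c *\<^sub>R mat 1) = 0}"
      by (intro AE_not_in finite_imp_null_set_lborel finite_singular_shifts)
    then have "AE c in lborel. w (B + c *\<^sub>R mat 1) * indicator {0..1::real} c = 0"
      by eventually_elim (simp add: w_def)
    then show "(\<integral>\<^sup>+c. w (B + c *\<^sub>R mat 1) * indicator {0..1::real} c \<partial>lborel) = 0"
      by (subst nn_integral_0_iff_AE) auto
  qed
  finally have "emeasure lborel {B :: complex^'m^'m. det B = 0} = 0"
    using meas by (simp add: w_def)
  then have "{B :: complex^'m^'m. det B = 0} \<in> null_sets lborel"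
    using meas by (intro null_setsI) auto
  then show ?thesis
    using AE_not_in by fastforce
qed

section \<open>Radial integrals of homogeneous functions\<close>

lemma scaling_scales_volume:
  assumes "0 < s"
  shows "scales_volume (\<lambda>x::'a::euclidean_space. s *\<^sub>R x) (s ^ DIM('a))"
  using diagonal_scales_volume[of "\<lambda>_. s" "\<lambda>x::'a. s *\<^sub>R x"] assms by simp

lemma nn_integral_power_upto:
  assumes "0 \<le> r" "0 < N"
  shows "(\<integral>\<^sup>+u. ennreal (u ^ (N - 1)) * indicator {0<..r} u \<partial>lborel) = ennreal (r ^ N / N)"
proof -
  have "(\<integral>\<^sup>+u. ennreal (u ^ (N - 1)) * indicator {0<..r} u \<partial>lborel) =
        (\<integral>\<^sup>+u. ennreal (u ^ (N - 1)) * indicator {0..r} u \<partial>lborel)"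
    by (rule nn_integral_cong_AE, rule AE_mp[OF AE_lborel_singleton[of 0]])
      (auto simp: indicator_def)
  also have "\<dots> = ennreal (r ^ N / N - 0 ^ N / N)"
    using assms
    by (intro nn_integral_FTC_Icc) (auto intro!: derivative_eq_intros)
  finally show ?thesis using assms by (simp only: zero_power div_0 diff_0_right)
qed

text \<open>Polar coordinates for a homogeneous weight. Write \<open>F r\<close> for the mass of the
  ball \<open>(norm x)\<^sup>2 \<le> r\<close> under the weight \<open>\<phi>\<close>. Substituting \<open>x \<mapsto> sqrt r x\<close> gives
  \<open>F r = r^N F 1\<close>, so the image of the weighted measure under \<open>(norm x)\<^sup>2\<close> agrees on all
  half-lines with the measure of density \<open>K u^(N - 1)\<close> on the positive reals, \<open>K = N F 1\<close>.
  The square of the norm is what \<^const>\<open>tr_sq\<close> is, and the even total degree \<open>2N\<close> keeps the exponents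
  natural numbers.\<close>

lemma radial_integral_homogeneous:
  fixes \<phi> :: "'a::euclidean_space \<Rightarrow> real"
  assumes cont: "continuous_on UNIV \<phi>" and nonneg: "\<And>x. 0 \<le> \<phi> x"
    and hom: "\<And>s x. 0 < s \<Longrightarrow> \<phi> (s *\<^sub>R x) = s ^ k * \<phi> x"
    and deg: "DIM('a) + k = 2 * N"
  obtains K where "0 \<le> K"
    "\<And>h. h \<in> borel_measurable borel \<Longrightarrow>
      (\<integral>\<^sup>+x. ennreal (\<phi> x) * h ((norm x)\<^sup>2) \<partial>lborel) =
      (\<integral>\<^sup>+u. (ennreal K * (ennreal (u ^ (N - 1)) * indicator {0<..} u)) * h u \<partial>lborel)"
proof -
  have [measurable]: "\<phi> \<in> borel_measurable borel"
    using cont by (rule borel_measurable_continuous_onI)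
  have N: "0 < N" using deg DIM_positive[where 'a='a] by linarith
  define F where "F r = (\<integral>\<^sup>+x. ennreal (\<phi> x) * indicator {..r} ((norm x)\<^sup>2) \<partial>lborel)" for r :: real
  have F_scale: "F r = ennreal (r ^ N) * F 1" if "0 < r" for r
  proof -
    define s where "s = sqrt r"
    have s: "0 < s" "s\<^sup>2 = r" using that by (auto simp: s_def)
    have iff: "(norm (s *\<^sub>R x))\<^sup>2 \<le> r \<longleftrightarrow> (norm x)\<^sup>2 \<le> 1" for x :: 'a
      using s that by (simp add: power_mult_distrib)
    have "F r = ennreal (s ^ DIM('a)) *
        (\<integral>\<^sup>+x. ennreal (\<phi> (s *\<^sub>R x)) * indicator {..r} ((norm (s *\<^sub>R x :: 'a))\<^sup>2) \<partial>lborel)"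
      unfolding F_def by (rule scales_volumeD[OF scaling_scales_volume[OF s(1)]]) measurable
    also have "(\<integral>\<^sup>+x. ennreal (\<phi> (s *\<^sub>R x)) * indicator {..r} ((norm (s *\<^sub>R x :: 'a))\<^sup>2) \<partial>lborel) =
        (\<integral>\<^sup>+x. ennreal (s ^ k) * (ennreal (\<phi> x) * indicator {..1} ((norm (x :: 'a))\<^sup>2)) \<partial>lborel)"
      using s nonneg iff by (intro nn_integral_cong) (simp add: hom ennreal_mult mult.assoc indicator_def)
    also have "\<dots> = ennreal (s ^ k) * F 1"
      unfolding F_def by (rule nn_integral_cmult) measurable
    finally have "F r = ennreal (s ^ (DIM('a) + k)) * F 1"
      using s by (simp add: ennreal_mult power_add mult.assoc)
    then show ?thesis
      using s by (simp add: deg power_mult)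
  qed
  have F_zero: "F r = 0" if "r \<le> 0" for r
  proof -
    have "AE x in lborel. ennreal (\<phi> x) * indicator {..r} ((norm x)\<^sup>2) = 0"
      using AE_lborel_singleton[of 0]
    proof eventually_elim
      case (elim x)
      then have "\<not> (norm x)\<^sup>2 \<le> r" using that by (smt (verit) zero_less_norm_iff zero_less_power)
      then show ?case by (simp add: indicator_def)
    qed
    then show ?thesis
      unfolding F_def by (subst nn_integral_0_iff_AE) auto
  qed
  have F1_finite: "F 1 < \<infinity>"
  proof -
    have "bounded (\<phi> ` cball 0 1)"
      by (intro compact_imp_bounded compact_continuous_image continuous_on_subset[OF cont]) auto
    then obtain b where "\<And>x. x \<in> cball 0 1 \<Longrightarrow> norm (\<phi> x) \<le> b"
      unfolding bounded_iff by blast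
    then have b: "\<phi> x \<le> b" if "x \<in> cball 0 1" for x
      using that by force
    have "F 1 \<le> (\<integral>\<^sup>+x. ennreal b * indicator (cball (0::'a) 1) x \<partial>lborel)"
      unfolding F_def using b
      by (intro nn_integral_mono) (auto simp: indicator_def abs_square_le_1 intro!: ennreal_leI)
    also have "\<dots> = ennreal b * emeasure lborel (cball (0::'a) 1)"
      by (rule nn_integral_cmult_indicator) simp
    also have "\<dots> < \<infinity>"
      using emeasure_bounded_finite[of "cball (0::'a) 1"] by (simp add: ennreal_mult_less_top)
    finally show ?thesis .
  qed
  define K where "K = N * enn2real (F 1)"
  have K: "0 \<le> K" by (simp add: K_def)
  have F1: "F 1 = ennreal (K / N)"
    using F1_finite N by (simp add: K_def)
  define \<nu> where "\<nu> = distr (density lborel (\<lambda>x. ennreal (\<phi> x))) borel (\<lambda>x. (norm x)\<^sup>2)"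
  define \<mu> where "\<mu> = density lborel (\<lambda>u. ennreal K * (ennreal (u ^ (N - 1)) * indicator {0<..} u))"
  have \<nu>: "emeasure \<nu> {..r} = F r" for r
    unfolding \<nu>_def F_def
    by (simp add: emeasure_distr emeasure_density vimage_def indicator_def)
  have \<mu>: "emeasure \<mu> {..r} = F r" for r
  proof -
    have "emeasure \<mu> {..r} =
        (\<integral>\<^sup>+u. ennreal K * (ennreal (u ^ (N - 1)) * indicator {0<..r} u) \<partial>lborel)"
      unfolding \<mu>_def
      by (subst emeasure_density) (auto intro!: nn_integral_cong simp: indicator_def)
    also have "\<dots> = ennreal K * (\<integral>\<^sup>+u. ennreal (u ^ (N - 1)) * indicator {0<..r} u \<partial>lborel)"
      by (rule nn_integral_cmult) measurable
    also have "\<dots> = F r"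
    proof (cases "0 < r")
      case True
      then show ?thesis
        using N K unfolding nn_integral_power_upto[OF less_imp_le[OF True] N]
        by (simp add: F_scale F1 mult.commute flip: ennreal_mult)
    next
      case False
      then show ?thesis by (simp add: F_zero)
    qed
    finally show ?thesis .
  qed
  have "\<nu> = \<mu>"
  proof (rule measure_eqI_generator_eq[where E="range atMost" and \<Omega>=UNIV and A="\<lambda>i. {..real i}"])
    show "Int_stable (range (atMost :: real \<Rightarrow> real set))"
      by (auto simp: Int_stable_def)
    show "sets \<nu> = sigma_sets UNIV (range atMost)" "sets \<mu> = sigma_sets UNIV (range atMost)"
      by (simp_all add: \<nu>_def \<mu>_def borel_eq_atMost)
    show "(\<Union>i. {..real i}) = UNIV"
      by (auto intro: real_arch_simple)
    show "emeasure \<nu> {..real i} \<noteq> \<infinity>" for i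
      using F_scale[of "real i"] F1 by (cases "i = 0") (auto simp: \<nu> F_zero ennreal_mult_eq_top_iff)
  qed (auto simp: \<nu> \<mu>)
  show ?thesis
  proof (rule that[OF K])
    fix h :: "real \<Rightarrow> ennreal" assume [measurable]: "h \<in> borel_measurable borel"
    have "(\<integral>\<^sup>+x. ennreal (\<phi> x) * h ((norm x)\<^sup>2) \<partial>lborel) = (\<integral>\<^sup>+u. h u \<partial>\<nu>)"
      unfolding \<nu>_def by (simp add: nn_integral_distr nn_integral_density)
    also have "\<dots> = (\<integral>\<^sup>+u. (ennreal K * (ennreal (u ^ (N - 1)) * indicator {0<..} u)) * h u \<partial>lborel)"
      unfolding \<open>\<nu> = \<mu>\<close> \<mu>_def by (simp add: nn_integral_density)
    finally show "(\<integral>\<^sup>+x. ennreal (\<phi> x) * h ((norm x)\<^sup>2) \<partial>lborel) = \<dots>" .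
  qed
qed

section \<open>Measurability of the block quotient\<close>

lemma borel_measurable_vecI:
  fixes f :: "'a \<Rightarrow> 'b::euclidean_space^'n"
  assumes "\<And>i. (\<lambda>x. f x $ i) \<in> borel_measurable M"
  shows "f \<in> borel_measurable M"
proof (subst borel_measurable_euclidean_space, rule ballI)
  fix b :: "'b^'n" assume "b \<in> Basis"
  then obtain i u where "b = axis i u" by (auto simp: Basis_vec_def)
  then show "(\<lambda>x. f x \<bullet> b) \<in> borel_measurable M"
    using assms[of i] by (simp add: inner_axis)
qed

lemma borel_measurable_vec_nth [measurable (raw)]:
  fixes f :: "'a \<Rightarrow> 'b::euclidean_space^'n"
  assumes "f \<in> borel_measurable M"
  shows "(\<lambda>x. f x $ i) \<in> borel_measurable M"
  by (rule borel_measurable_continuous_on[OF _ assms]) (intro continuous_intros)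

lemma matrix_inv_left:
  fixes B :: "complex^'m^'m"
  assumes "det B \<noteq> 0"
  shows "matrix_inv B ** B = mat 1"
proof -
  obtain B' where "B ** B' = mat 1" "B' ** B = mat 1"
    using assms by (rule det_nonzero_inverse)
  then have "B ** matrix_inv B = mat 1 \<and> matrix_inv B ** B = mat 1"
    unfolding matrix_inv_def
    by (intro someI[of "\<lambda>A'. B ** A' = mat 1 \<and> A' ** B = mat 1" B'] conjI)
  then show ?thesis by simp
qed

lemma matrix_inv_singular:
  fixes B :: "complex^'m^'m"
  assumes "det B = 0"
  shows "matrix_inv B = matrix_inv 0"
proof -
  have "\<not> (B ** B' = mat 1 \<and> B' ** B = mat 1)" for B'
    using assms det_nonzero_if_right_inverse[of B B'] by blast
  moreover have "\<not> ((0 :: complex^'m^'m) ** B' = mat 1 \<and> B' ** 0 = mat 1)" for B'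
  proof -
    have "((0 :: complex^'m^'m) ** B') $ i $ i = 0" for i
      by (simp add: matrix_matrix_mult_def)
    then show ?thesis by (auto simp: mat_def vec_eq_iff)
  qed
  ultimately show ?thesis unfolding matrix_inv_def by metis
qed

text \<open>On invertible matrices Cramer's rule expresses the entries as quotients of determinants; on the
  singular ones \<^const>\<open>matrix_inv\<close> is constant because the predicate that it selects from is empty.\<close>

lemma borel_measurable_matrix_inv [measurable (raw)]:
  fixes f :: "'a \<Rightarrow> complex^'m^'m"
  assumes [measurable]: "f \<in> borel_measurable M"
  shows "(\<lambda>x. matrix_inv (f x)) \<in> borel_measurable M"
proof -
  define minor where
    "minor k l B = (\<chi> i j. if j = k then axis l 1 $ i else B $ i $ j)" for k l and B :: "complex^'m^'m"
  have [measurable]: "(\<lambda>x. minor k l (f x)) \<in> borel_measurable M" for k l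
    unfolding minor_def
    by (intro borel_measurable_vecI) simp
  have inv_entry: "matrix_inv B $ k $ l = (if det B = 0 then matrix_inv 0 $ k $ l else det (minor k l B) / det B)"
    for k l and B :: "complex^'m^'m"
  proof (cases "det B = 0")
    case False
    have "B *v (matrix_inv B *v axis l 1) = axis l 1"
      using matrix_inv_left[OF False] by (simp add: matrix_vector_mul_assoc matrix_left_right_inverse)
    then have "matrix_inv B *v axis l 1 = (\<chi> k. det (minor k l B) / det B)"
      unfolding cramer[OF False] minor_def .
    moreover have "(matrix_inv B *v axis l 1) $ k = matrix_inv B $ k $ l"
      by (simp add: matrix_vector_mult_def axis_def if_distrib cong: if_cong)
    ultimately show ?thesis
      using False by simp
  qed (simp add: matrix_inv_singular)
  show ?thesis
    by (intro borel_measurable_vecI) (simp add: inv_entry)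
qed

lemma borel_measurable_select_columns [measurable (raw)]:
  fixes f :: "'a \<Rightarrow> complex^'k^'m"
  assumes [measurable]: "f \<in> borel_measurable M"
  shows "(\<lambda>x. select_columns c (f x)) \<in> borel_measurable M"
  unfolding select_columns_def by (intro borel_measurable_vecI) simp

lemma borel_measurable_det_one_plus [measurable (raw)]:
  fixes f :: "'a \<Rightarrow> complex^'n^'m"
  assumes "f \<in> borel_measurable M"
  shows "(\<lambda>x. det_one_plus (f x)) \<in> borel_measurable M"
  unfolding det_one_plus_def conj_transpose_def
  by (rule borel_measurable_continuous_on[OF _ assms]) (intro continuous_intros)

lemma tr_sq_sum: "tr_sq A = (\<Sum>i\<in>UNIV. \<Sum>j\<in>UNIV. (cmod (A $ i $ j))\<^sup>2)"
  by (simp add: tr_sq_def trace_conj_transpose)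



section \<open>Integrating out the square block\<close>

text \<open>The block matrix \<open>[1 | Z]\<close>. If \<open>B\<close> is the square block of \<open>A\<close> and \<open>Z\<close> the quotient, then
  \<open>A = B [1 | Z]\<close> up to the order of the columns.\<close>

definition adjoin_identity :: "complex^'n^'m \<Rightarrow> complex^('m + 'n)^'m" where
  "adjoin_identity Z = (\<chi> i j. case j of Inl l \<Rightarrow> mat 1 $ i $ l | Inr l \<Rightarrow> Z $ i $ l)"

lemma sum_UNIV_Plus:
  "(\<Sum>j\<in>(UNIV :: ('m::finite + 'n::finite) set). f j) = (\<Sum>l\<in>UNIV. f (Inl l)) + (\<Sum>l\<in>UNIV. f (Inr l))"
  by (simp add: sum.Plus flip: UNIV_Plus_UNIV)

lemma gram_adjoin_identity:
  fixes Z :: "complex^'n^'m"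
  shows "gram (adjoin_identity Z) = mat 1 + Z ** conj_transpose Z"
proof -
  have "gram (adjoin_identity Z) $ i $ j = (mat 1 + Z ** conj_transpose Z) $ i $ j" for i j
  proof -
    have "(\<Sum>l\<in>UNIV. mat 1 $ i $ l * cnj (mat 1 $ j $ l)) = (mat 1 :: complex^'m^'m) $ i $ j"
      using gram_entry[of "mat 1 :: complex^'m^'m" i j] by simp
    then show ?thesis
      unfolding gram_entry vector_add_component sum_UNIV_Plus by (simp add: adjoin_identity_def)
  qed
  then show ?thesis by (simp add: vec_eq_iff)
qed

lemma mult_adjoin_identity:
  "(B ** adjoin_identity Z) $ i $ Inl l = B $ i $ l"
  "(B ** adjoin_identity Z) $ i $ Inr l' = (B ** Z) $ i $ l'"
proof -
  have "(B ** adjoin_identity Z) $ i $ Inl l = (B ** mat 1) $ i $ l"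
    unfolding matrix_matrix_mult_def by (simp add: adjoin_identity_def)
  then show "(B ** adjoin_identity Z) $ i $ Inl l = B $ i $ l" by simp
  show "(B ** adjoin_identity Z) $ i $ Inr l' = (B ** Z) $ i $ l'"
    unfolding matrix_matrix_mult_def by (simp add: adjoin_identity_def)
qed

lemma tr_sq_mult_adjoin_identity:
  "tr_sq (B ** adjoin_identity Z) = tr_sq B + tr_sq (B ** Z)"
  unfolding tr_sq_sum sum_UNIV_Plus mult_adjoin_identity by (simp add: sum.distrib)

lemma adjoin_identity_independent_rows:
  assumes "v v* adjoin_identity Z = 0"
  shows "v = 0"
proof -
  have "(v v* adjoin_identity Z) $ Inl l = v $ l" for l
  proof -
    have "(v v* adjoin_identity Z) $ Inl l = (v v* mat 1) $ l"
      unfolding vector_matrix_mult_def by (simp add: adjoin_identity_def)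
    then show ?thesis by simp
  qed
  then show ?thesis using assms by (simp add: vec_eq_iff)
qed

lemma tr_sq_mult_orthonormal_rows:
  assumes "gram W = mat 1"
  shows "tr_sq (B ** W) = tr_sq B"
proof -
  have "gram (B ** W) = B ** gram W ** conj_transpose B"
    by (simp add: conj_transpose_mult matrix_mul_assoc)
  then show ?thesis by (simp add: tr_sq_def assms)
qed

text \<open>The matrix \<open>T\<close> makes the rows of \<open>T [1 | Z]\<close> orthonormal, that is
  \<open>T (1 + Z Z\<^sup>\<dagger>) T\<^sup>\<dagger> = 1\<close>; the last claim is the determinant of this identity.\<close>

lemma orthonormalise_adjoin_identity:
  fixes Z :: "complex^'n^'m"
  obtains T :: "complex^'m^'m" where "det T \<noteq> 0"
    "\<And>B :: complex^'m^'m. tr_sq (B ** T) + tr_sq (B ** T ** Z) = tr_sq B"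
    "det_one_plus Z * (cmod (det T))\<^sup>2 = 1"
proof -
  have ind: "v = 0" if "v v* adjoin_identity Z = 0" for v
    using that by (rule adjoin_identity_independent_rows)
  obtain T :: "complex^'m^'m" where T: "det_scales TYPE('m) T" "gram (T ** adjoin_identity Z) = mat 1"
    using gram_schmidt[OF ind, where 'n='m] by metis
  have "tr_sq (B ** T) + tr_sq (B ** T ** Z) = tr_sq B" for B :: "complex^'m^'m"
    using tr_sq_mult_orthonormal_rows[OF T(2), of B]
    by (simp add: matrix_mul_assoc tr_sq_mult_adjoin_identity)
  moreover have "det_one_plus Z * (cmod (det T))\<^sup>2 = 1"
  proof -
    let ?H = "mat 1 + Z ** conj_transpose Z"
    have "T ** ?H ** conj_transpose T = mat 1"
      using T(2) unfolding gram_adjoin_identity[symmetric]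
      by (simp add: conj_transpose_mult matrix_mul_assoc)
    from arg_cong[OF this, of det] have "det ?H * (det T * cnj (det T)) = 1"
      by (simp add: det_mul det_conj_transpose mult_ac)
    then have "det ?H * of_real ((cmod (det T))\<^sup>2) = 1"
      by (simp only: complex_norm_square)
    then have "Re (det ?H * of_real ((cmod (det T))\<^sup>2)) = 1" by simp
    then show ?thesis
      by (simp add: det_one_plus_def del: of_real_power)
  qed
  ultimately show ?thesis
    using that T(1) unfolding det_scales_def by blast
qed

lemma det_one_plus_pos:
  fixes Z :: "complex^'n^'m"
  shows "0 < det_one_plus Z"
proof -
  obtain T :: "complex^'m^'m" where T: "det_one_plus Z * (cmod (det T))\<^sup>2 = 1"
    using orthonormalise_adjoin_identity[of Z] by blast
  then show ?thesis
    using mult_nonpos_nonneg[of "det_one_plus Z" "(cmod (det T))\<^sup>2"] by fastforce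
qed

text \<open>Substitute \<open>B T\<close> for \<open>B\<close>, with \<open>T\<close> orthonormalising the rows of \<open>[1 | Z]\<close>. The argument of
  \<open>h\<close> becomes \<open>tr_sq B\<close>; the Jacobian contributes \<open>\<bar>det T\<bar>\<close> to the power \<open>2m\<close> and the weight contributes
  the power \<open>2n\<close>, where \<open>\<bar>det T\<bar>\<^sup>2\<close> is the inverse of \<open>det (1 + Z Z\<^sup>\<dagger>)\<close>.\<close>

lemma integral_square_block:
  fixes Z :: "complex^'n^'m"
  assumes [measurable]: "h \<in> borel_measurable borel"
  shows "(\<integral>\<^sup>+B. ennreal (cmod (det B) ^ (2 * CARD('n))) * h (tr_sq B + tr_sq (B ** Z)) \<partial>lborel) =
    ennreal (1 / det_one_plus Z ^ (CARD('m) + CARD('n))) *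
    (\<integral>\<^sup>+(B :: complex^'m^'m). ennreal (cmod (det B) ^ (2 * CARD('n))) * h (tr_sq B) \<partial>lborel)"
    (is "?l = _ * ?r")
proof -
  obtain T :: "complex^'m^'m" where T: "det T \<noteq> 0"
    "\<And>B :: complex^'m^'m. tr_sq (B ** T) + tr_sq (B ** T ** Z) = tr_sq B"
    "det_one_plus Z * (cmod (det T))\<^sup>2 = 1"
    using orthonormalise_adjoin_identity[of Z] by blast
  have "?l = ennreal (cmod (det T) ^ (2 * CARD('m))) *
      (\<integral>\<^sup>+B. ennreal (cmod (det (B ** T)) ^ (2 * CARD('n))) *
        h (tr_sq (B ** T) + tr_sq (B ** T ** Z)) \<partial>lborel)"
    by (rule scales_volumeD[OF det_nonzero_scales_volume_right[OF T(1)]]) measurable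
  also have "(\<integral>\<^sup>+B. ennreal (cmod (det (B ** T)) ^ (2 * CARD('n))) *
        h (tr_sq (B ** T) + tr_sq (B ** T ** Z)) \<partial>lborel) =
      (\<integral>\<^sup>+(B :: complex^'m^'m). ennreal (cmod (det T) ^ (2 * CARD('n))) *
        (ennreal (cmod (det B) ^ (2 * CARD('n))) * h (tr_sq B)) \<partial>lborel)"
    unfolding T(2)
    by (intro nn_integral_cong) (simp add: det_mul norm_mult power_mult_distrib ennreal_mult mult_ac)
  also have "\<dots> = ennreal (cmod (det T) ^ (2 * CARD('n))) * ?r"
    by (rule nn_integral_cmult) measurable
  finally have "?l = ennreal (((cmod (det T))\<^sup>2) ^ (CARD('m) + CARD('n))) * ?r"
    by (simp add: power_add power_mult ennreal_mult mult.assoc)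
  also have "(cmod (det T))\<^sup>2 = 1 / det_one_plus Z"
    using T(3) det_one_plus_pos[of Z] by (simp add: field_simps)
  finally show ?thesis by (simp add: power_one_over)
qed

section \<open>Splitting the columns\<close>

lemma column_partition_sum:
  fixes f :: "'k::finite \<Rightarrow> 'a::comm_monoid_add"
  assumes "column_partition (b :: 'm::finite \<Rightarrow> 'k) (x :: 'n::finite \<Rightarrow> 'k)"
  shows "(\<Sum>l\<in>UNIV. f l) = (\<Sum>j\<in>UNIV. f (b j)) + (\<Sum>j\<in>UNIV. f (x j))"
proof -
  have p: "inj b" "inj x" "range b \<inter> range x = {}" "range b \<union> range x = UNIV"
    using assms by (auto simp: column_partition_def)
  have "(\<Sum>l\<in>UNIV. f l) = (\<Sum>l\<in>range b. f l) + (\<Sum>l\<in>range x. f l)"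
    using p(3) by (subst p(4)[symmetric], subst sum.union_disjoint) auto
  then show ?thesis using p(1,2) by (simp add: sum.reindex)
qed

lemma tr_sq_column_partition:
  fixes A :: "complex^'k^'m"
  assumes "column_partition (b :: 'm \<Rightarrow> 'k) (x :: 'n::finite \<Rightarrow> 'k)"
  shows "tr_sq A = tr_sq (select_columns b A) + tr_sq (select_columns x A)"
  unfolding tr_sq_sum column_partition_sum[OF assms] select_columns_def
  by (simp add: sum.distrib)

lemma column_partition_scales_volume:
  fixes b :: "'m::finite \<Rightarrow> 'k::finite" and x :: "'n::finite \<Rightarrow> 'k"
  assumes part: "column_partition b x"
  shows "scales_volume
    (\<lambda>A::complex^'k^'m. (select_columns b A :: complex^'m^'m, select_columns x A :: complex^'n^'m)) 1"
    (is "scales_volume ?L 1")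
proof (rule scales_volume_isometry)
  show "linear ?L"
    by (rule linearI) (simp_all add: select_columns_def vec_eq_iff)
  show "norm (?L A) = norm A" for A
  proof -
    have "(norm (?L A))\<^sup>2 = (norm A)\<^sup>2"
      using tr_sq_column_partition[OF part, of A] by (simp add: norm_Pair tr_sq_eq_norm)
    then show ?thesis by simp
  qed
  have p: "inj b" "inj x" "range b \<inter> range x = {}"
    using part by (auto simp: column_partition_def)
  show "surj ?L"
  proof (rule surjI)
    fix P :: "(complex^'m^'m) \<times> (complex^'n^'m)"
    have "x j \<notin> range b" for j using p(3) by auto
    then show "?L (\<chi> i l. if l \<in> range b then fst P $ i $ inv b l else snd P $ i $ inv x l) = P"
      using p(1,2) by (simp add: select_columns_def prod_eq_iff vec_eq_iff)
  qed
qed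

text \<open>Split \<open>A\<close> into its blocks \<open>B\<close> and \<open>X\<close>, substitute \<open>X = B Z\<close> with Jacobian
  \<open>\<bar>det B\<bar>\<close> to the power \<open>2n\<close> for the almost all \<open>B\<close> that are invertible, and integrate over \<open>B\<close>
  first.\<close>

lemma integral_block_quotient:
  fixes b :: "'m::finite \<Rightarrow> 'k::finite" and x :: "'n::finite \<Rightarrow> 'k"
  assumes part: "column_partition b x"
    and [measurable]: "h \<in> borel_measurable borel" "F \<in> borel_measurable borel"
  shows "(\<integral>\<^sup>+(A :: complex^'k^'m).
      h (tr_sq A) * F (matrix_inv (select_columns b A) ** select_columns x A) \<partial>lborel) =
    (\<integral>\<^sup>+(Z :: complex^'n^'m).
      (\<integral>\<^sup>+(B :: complex^'m^'m). ennreal (cmod (det B) ^ (2 * CARD('n))) * h (tr_sq B) \<partial>lborel) *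
      ennreal (1 / det_one_plus Z ^ (CARD('m) + CARD('n))) * F Z \<partial>lborel)"
    (is "?l = _")
proof -
  define G where "G B X = h (tr_sq B + tr_sq X) * F (matrix_inv B ** X)"
    for B :: "complex^'m^'m" and X :: "complex^'n^'m"
  have G [measurable]: "case_prod G \<in> borel_measurable (borel \<Otimes>\<^sub>M borel)"
    unfolding G_def by measurable
  have G' [measurable]: "G B \<in> borel_measurable borel" for B
    unfolding G_def by measurable
  have "?l = (\<integral>\<^sup>+(A :: complex^'k^'m). case_prod G (select_columns b A, select_columns x A) \<partial>lborel)"
    by (simp add: G_def tr_sq_column_partition[OF part])
  also have "\<dots> = (\<integral>\<^sup>+P. case_prod G P \<partial>lborel)"
    using scales_volumeD[OF column_partition_scales_volume[OF part], of "case_prod G"] G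
    by (simp add: borel_prod)
  also have "\<dots> = (\<integral>\<^sup>+P. case_prod G P \<partial>(lborel \<Otimes>\<^sub>M lborel))"
    by (simp add: lborel_prod)
  also have "\<dots> = (\<integral>\<^sup>+B. (\<integral>\<^sup>+X. G B X \<partial>lborel) \<partial>lborel)"
    by (subst lborel.nn_integral_fst[symmetric]) simp_all
  also have "\<dots> = (\<integral>\<^sup>+B. (\<integral>\<^sup>+Z. ennreal (cmod (det B) ^ (2 * CARD('n))) *
      h (tr_sq B + tr_sq (B ** Z)) * F Z \<partial>lborel) \<partial>lborel)"
  proof (rule nn_integral_cong_AE)
    show "AE B in lborel. (\<integral>\<^sup>+X. G B X \<partial>lborel) =
        (\<integral>\<^sup>+Z. ennreal (cmod (det B) ^ (2 * CARD('n))) * h (tr_sq B + tr_sq (B ** Z)) * F Z \<partial>lborel)"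
      using AE_det_nonzero
    proof eventually_elim
      case (elim B)
      have "(\<integral>\<^sup>+X. G B X \<partial>lborel) =
          ennreal (cmod (det B) ^ (2 * CARD('n))) * (\<integral>\<^sup>+Z. G B (B ** Z) \<partial>lborel)"
        by (rule scales_volumeD[OF det_nonzero_scales_volume_left[OF elim]]) measurable
      also have "\<dots> = (\<integral>\<^sup>+Z. ennreal (cmod (det B) ^ (2 * CARD('n))) * G B (B ** Z) \<partial>lborel)"
        by (rule nn_integral_cmult[symmetric]) measurable
      finally show ?case
        by (simp add: G_def matrix_mul_assoc matrix_inv_left[OF elim] mult.assoc)
    qed
  qed
  also have "\<dots> = (\<integral>\<^sup>+Z. (\<integral>\<^sup>+B. ennreal (cmod (det B) ^ (2 * CARD('n))) *
      h (tr_sq B + tr_sq (B ** Z)) * F Z \<partial>lborel) \<partial>lborel)"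
    by (rule lborel_pair.Fubini'[symmetric]) measurable
  also have "\<dots> = (\<integral>\<^sup>+Z. (\<integral>\<^sup>+B. ennreal (cmod (det B) ^ (2 * CARD('n))) *
      h (tr_sq B + tr_sq (B ** Z)) \<partial>lborel) * F Z \<partial>lborel)"
    by (simp add: nn_integral_multc)
  finally show ?thesis
    unfolding integral_square_block[OF assms(2)] by (simp add: mult.commute)
qed

section \<open>The universal density\<close>

text \<open>The weight is homogeneous of degree \<open>2mn\<close> on a space of real dimension \<open>2m\<^sup>2\<close>, so the
  radial density has degree \<open>m(m + n) - 1\<close>. Integrating \<open>f\<close> against it gives a multiple of the
  moment that admissibility prescribes.\<close>

lemma radial_integral_det_power:
  obtains K where "0 \<le> K"
    "\<And>h. h \<in> borel_measurable borel \<Longrightarrow>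
      (\<integral>\<^sup>+(B :: complex^'m^'m). ennreal (cmod (det B) ^ (2 * n)) * h (tr_sq B) \<partial>lborel) =
      (\<integral>\<^sup>+u. (ennreal K * (ennreal (u ^ (CARD('m) * (CARD('m) + n) - 1)) * indicator {0<..} u)) * h u \<partial>lborel)"
proof (rule radial_integral_homogeneous[of "\<lambda>B :: complex^'m^'m. cmod (det B) ^ (2 * n)"
      "CARD('m) * (2 * n)" "CARD('m) * (CARD('m) + n)"])
  show "continuous_on UNIV (\<lambda>B :: complex^'m^'m. cmod (det B) ^ (2 * n))"
    by (intro continuous_intros)
  fix s :: real and B :: "complex^'m^'m" assume s: "0 < s"
  have "s *\<^sub>R B = (\<chi> i j. of_real s * B $ i $ j)"
    by (simp add: vec_eq_iff, simp add: scaleR_conv_of_real)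
  then have "det (s *\<^sub>R B) = of_real s ^ CARD('m) * det B"
    by (simp only: det_scale)
  then show "cmod (det (s *\<^sub>R B)) ^ (2 * n) = s ^ (CARD('m) * (2 * n)) * cmod (det B) ^ (2 * n)"
    using s by (simp add: norm_mult norm_power power_mult_distrib power_mult)
qed (use that in \<open>auto simp: tr_sq_eq_norm algebra_simps\<close>)

lemma sphere_area_pos: "0 < d \<Longrightarrow> 0 < sphere_area d"
  by (simp add: sphere_area_def)

lemma admissible_nn_integral:
  assumes "admissible m n f" "0 < m"
  shows "(\<integral>\<^sup>+u. ennreal (u ^ (m * (m + n) - 1)) * indicator {0<..} u * ennreal (f u) \<partial>lborel) =
    ennreal (2 / sphere_area (2 * m * (m + n)))"
proof -
  let ?N = "m * (m + n)"
  define q where "q u = indicator {0<..} u * (u ^ (?N - 1) * f u)" for u :: real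
  \<comment> \<open>A non-integrable function has integral 0, so a positive value forces integrability.\<close>
  have "0 < 2 / sphere_area (2 * m * (m + n))"
    using assms(2) by (simp add: sphere_area_pos)
  moreover have q_int: "(\<integral>u. q u \<partial>lborel) = 2 / sphere_area (2 * m * (m + n))"
    using assms(1) by (simp add: admissible_def set_lebesgue_integral_def q_def)
  ultimately have "integrable lborel q"
    using not_integrable_integral_eq by fastforce
  moreover have "0 \<le> q u" for u
    using assms(1) by (simp add: q_def admissible_def indicator_def)
  ultimately have "(\<integral>\<^sup>+u. ennreal (q u) \<partial>lborel) = ennreal (2 / sphere_area (2 * m * (m + n)))"
    by (simp add: nn_integral_eq_integral q_int)
  moreover have "ennreal (q u) = ennreal (u ^ (?N - 1)) * indicator {0<..} u * ennreal (f u)" for u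
    using assms(1) by (simp add: q_def admissible_def indicator_def ennreal_mult)
  ultimately show ?thesis by simp
qed

lemma AE_tr_sq_pos: "AE A in lborel. 0 < tr_sq (A :: complex^'n^'m)"
  using AE_lborel_singleton[of 0] by eventually_elim (simp add: tr_sq_eq_norm)

text \<open>Admissibility constrains \<open>f\<close> only on the positive reals. Its truncation by zero is Borel
  on the whole line, and composed with \<^const>\<open>tr_sq\<close> the two agree off the zero matrix.\<close>

lemma admissible_truncation_measurable:
  assumes "admissible m n f"
  shows "(\<lambda>u. indicator {0<..} u * f u) \<in> borel_measurable borel"
  using assms borel_measurable_restrict_space_iff[of "{0<..}" borel f]
  by (simp add: admissible_def)

lemma admissible_tr_sq_measurable:
  fixes f :: "real \<Rightarrow> real"
  assumes "admissible m n f"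
  shows "(\<lambda>A :: complex^'n^'m. f (tr_sq A)) \<in> borel_measurable borel"
proof -
  define f0 where "f0 u = indicator {0<..} u * f u" for u :: real
  have [measurable]: "f0 \<in> borel_measurable borel"
    unfolding f0_def using assms by (rule admissible_truncation_measurable)
  have "(\<lambda>A :: complex^'n^'m. f (tr_sq A)) = (\<lambda>A. if A = 0 then f 0 else f0 (tr_sq A))"
    by (auto simp: f0_def tr_sq_eq_norm)
  then show ?thesis by simp
qed

text \<open>The radial form of the integral depends on \<open>f\<close> only through its prescribed moment.\<close>

lemma universal_constant:
  "\<exists>C\<ge>0. \<forall>f. admissible CARD('m::finite) n f \<longrightarrow>
    (\<integral>\<^sup>+(B :: complex^'m^'m).
      ennreal (cmod (det B) ^ (2 * n)) * ennreal (f (tr_sq B)) \<partial>lborel) = ennreal C"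
proof -
  let ?N = "CARD('m) * (CARD('m) + n)"
  define moment where "moment = 2 / sphere_area (2 * CARD('m) * (CARD('m) + n))"
  have "0 \<le> moment"
    by (simp add: moment_def sphere_area_pos less_imp_le)
  obtain K where K: "0 \<le> K"
    and radial: "\<And>h. h \<in> borel_measurable borel \<Longrightarrow>
      (\<integral>\<^sup>+(B :: complex^'m^'m). ennreal (cmod (det B) ^ (2 * n)) * h (tr_sq B) \<partial>lborel) =
      (\<integral>\<^sup>+u. (ennreal K * (ennreal (u ^ (?N - 1)) * indicator {0<..} u)) * h u \<partial>lborel)"
    using radial_integral_det_power[where 'm='m and n=n] by blast
  have "(\<integral>\<^sup>+(B :: complex^'m^'m). ennreal (cmod (det B) ^ (2 * n)) * ennreal (f (tr_sq B)) \<partial>lborel) =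
      ennreal (K * moment)" if adm: "admissible CARD('m) n f" for f
  proof -
    define f0 where "f0 u = indicator {0<..} u * f u" for u :: real
    have f0 [measurable]: "f0 \<in> borel_measurable borel"
      unfolding f0_def using adm by (rule admissible_truncation_measurable)
    have "(\<integral>\<^sup>+(B :: complex^'m^'m). ennreal (cmod (det B) ^ (2 * n)) * ennreal (f (tr_sq B)) \<partial>lborel) =
        (\<integral>\<^sup>+(B :: complex^'m^'m). ennreal (cmod (det B) ^ (2 * n)) * ennreal (f0 (tr_sq B)) \<partial>lborel)"
      by (rule nn_integral_cong_AE, rule AE_mp[OF AE_tr_sq_pos]) (simp add: f0_def)
    also have "\<dots> =
        (\<integral>\<^sup>+u. (ennreal K * (ennreal (u ^ (?N - 1)) * indicator {0<..} u)) * ennreal (f0 u) \<partial>lborel)"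
      by (rule radial) measurable
    also have "\<dots> =
        (\<integral>\<^sup>+u. ennreal K * (ennreal (u ^ (?N - 1)) * indicator {0<..} u * ennreal (f0 u)) \<partial>lborel)"
      by (simp add: mult.assoc)
    also have "\<dots> =
        ennreal K * (\<integral>\<^sup>+u. ennreal (u ^ (?N - 1)) * indicator {0<..} u * ennreal (f0 u) \<partial>lborel)"
      by (rule nn_integral_cmult) measurable
    also have "(\<integral>\<^sup>+u. ennreal (u ^ (?N - 1)) * indicator {0<..} u * ennreal (f0 u) \<partial>lborel) =
        (\<integral>\<^sup>+u. ennreal (u ^ (?N - 1)) * indicator {0<..} u * ennreal (f u) \<partial>lborel)"
      by (intro nn_integral_cong) (simp add: f0_def indicator_def)
    also have "\<dots> = ennreal moment"
      unfolding moment_def by (rule admissible_nn_integral[OF adm]) simp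
    finally show ?thesis
      using K by (simp add: ennreal_mult')
  qed
  then show ?thesis
    using K \<open>0 \<le> moment\<close> by (intro exI[of _ "K * moment"]) simp
qed

text \<open>Tested on the indicator function of a Borel set, the claim is the integral identity for
  the block quotient.\<close>

lemma block_quotient_distributed:
  fixes A :: "'w \<Rightarrow> complex^'k^'m" and b :: "'m \<Rightarrow> 'k" and x :: "'n::finite \<Rightarrow> 'k"
  assumes adm: "admissible CARD('m) CARD('n) f" and "0 \<le> C"
    and C: "(\<integral>\<^sup>+(B :: complex^'m^'m).
      ennreal (cmod (det B) ^ (2 * CARD('n))) * ennreal (f (tr_sq B)) \<partial>lborel) = ennreal C"
    and dist: "distributed M lborel A (\<lambda>a. ennreal (f (tr_sq a)))"
    and part: "column_partition b x"
  shows "distributed M lborel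
      (\<lambda>\<omega>. matrix_inv (select_columns b (A \<omega>)) ** select_columns x (A \<omega>))
      (\<lambda>Z :: complex^'n^'m. ennreal (C / det_one_plus Z ^ (CARD('m) + CARD('n))))"
proof -
  define Q :: "complex^'k^'m \<Rightarrow> complex^'n^'m"
    where "Q a = matrix_inv (select_columns b a) ** select_columns x a" for a
  define P :: "complex^'n^'m \<Rightarrow> ennreal"
    where "P Z = ennreal (C / det_one_plus Z ^ (CARD('m) + CARD('n)))" for Z
  define f0 where "f0 u = indicator {0<..} u * f u" for u :: real
  have f0 [measurable]: "f0 \<in> borel_measurable borel"
    unfolding f0_def using adm by (rule admissible_truncation_measurable)
  \<comment> \<open>The shape of the matrix is left open: this applies to \<open>A\<close> and to its square block.\<close>
  have f_f0: "ennreal (f (tr_sq a)) = ennreal (f0 (tr_sq a))" if "0 < tr_sq a" for a :: "complex^'p^'q"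
    using that by (simp add: f0_def)
  have A [measurable]: "A \<in> borel_measurable M"
    using distributed_measurable[OF dist] by simp
  have Q [measurable]: "Q \<in> borel_measurable borel"
    unfolding Q_def by measurable
  have P [measurable]: "P \<in> borel_measurable borel"
    unfolding P_def by measurable
  have C0: "(\<integral>\<^sup>+(B :: complex^'m^'m).
      ennreal (cmod (det B) ^ (2 * CARD('n))) * ennreal (f0 (tr_sq B)) \<partial>lborel) = ennreal C"
    unfolding C[symmetric]
    by (rule nn_integral_cong_AE, rule AE_mp[OF AE_tr_sq_pos]) (simp add: f_f0)
  have "distr M lborel (\<lambda>\<omega>. Q (A \<omega>)) = density lborel P"
  proof (rule measure_eqI)
    fix E assume "E \<in> sets (distr M lborel (\<lambda>\<omega>. Q (A \<omega>)))"
    then have [measurable]: "E \<in> sets borel" by simp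
    have "emeasure (distr M lborel (\<lambda>\<omega>. Q (A \<omega>))) E = (\<integral>\<^sup>+\<omega>. indicator E (Q (A \<omega>)) \<partial>M)"
      by (subst nn_integral_indicator[symmetric], simp, subst nn_integral_distr) simp_all
    also have "\<dots> = (\<integral>\<^sup>+a. ennreal (f (tr_sq a)) * indicator E (Q a) \<partial>lborel)"
      by (rule distributed_nn_integral[OF dist, symmetric]) measurable
    also have "\<dots> = (\<integral>\<^sup>+a. ennreal (f0 (tr_sq a)) * indicator E (Q a) \<partial>lborel)"
      by (rule nn_integral_cong_AE, rule AE_mp[OF AE_tr_sq_pos]) (simp add: f_f0)
    also have "\<dots> = (\<integral>\<^sup>+Z. ennreal C *
        ennreal (1 / det_one_plus Z ^ (CARD('m) + CARD('n))) * indicator E Z \<partial>lborel)"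
      unfolding Q_def C0[symmetric] by (rule integral_block_quotient[OF part]) measurable
    also have "\<dots> = (\<integral>\<^sup>+Z. P Z * indicator E Z \<partial>lborel)"
      using \<open>0 \<le> C\<close> by (simp add: P_def flip: ennreal_mult')
    also have "\<dots> = emeasure (density lborel P) E"
      by (rule emeasure_density[symmetric]) simp_all
    finally show "emeasure (distr M lborel (\<lambda>\<omega>. Q (A \<omega>))) E = emeasure (density lborel P) E" .
  qed simp
  moreover have "(\<lambda>\<omega>. Q (A \<omega>)) \<in> borel_measurable M" by measurable
  ultimately have "distributed M lborel (\<lambda>\<omega>. Q (A \<omega>)) P"
    by (simp add: distributed_def)
  then show ?thesis
    unfolding Q_def P_def .
qed

theorem theorem3p1:
  "\<exists>C::real. \<forall>f. admissible CARD('m::finite) CARD('n::finite) f \<longrightarrow>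
     has_bochner_integral lborel
       (\<lambda>B :: complex^'m^'m. f (tr_sq B) * cmod (det B) ^ (2 * CARD('n))) C \<and>
     (\<forall>(M :: 'w measure) (A :: 'w \<Rightarrow> complex^('k::finite)^'m) (b :: 'm \<Rightarrow> 'k) (x :: 'n \<Rightarrow> 'k).
        prob_space M \<longrightarrow>
        distributed M lborel A (\<lambda>a. ennreal (f (tr_sq a))) \<longrightarrow>
        column_partition b x \<longrightarrow>
        distributed M lborel
          (\<lambda>\<omega>. matrix_inv (select_columns b (A \<omega>)) ** select_columns x (A \<omega>))
          (\<lambda>Z :: complex^'n^'m. ennreal (C / det_one_plus Z ^ (CARD('m) + CARD('n)))))"
proof -
  obtain C where "0 \<le> C" and C: "\<And>f. admissible CARD('m) CARD('n) f \<Longrightarrow>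
      (\<integral>\<^sup>+(B :: complex^'m^'m).
        ennreal (cmod (det B) ^ (2 * CARD('n))) * ennreal (f (tr_sq B)) \<partial>lborel) = ennreal C"
    using universal_constant[where 'm='m and n="CARD('n)"] by blast
  show ?thesis
  proof (intro exI[of _ C] allI impI conjI)
    fix f assume adm: "admissible CARD('m) CARD('n) f"
    show "has_bochner_integral lborel
       (\<lambda>B :: complex^'m^'m. f (tr_sq B) * cmod (det B) ^ (2 * CARD('n))) C"
    proof (rule has_bochner_integral_nn_integral)
      have [measurable]: "(\<lambda>B :: complex^'m^'m. f (tr_sq B)) \<in> borel_measurable borel"
        using adm by (rule admissible_tr_sq_measurable)
      show "(\<lambda>B :: complex^'m^'m. f (tr_sq B) * cmod (det B) ^ (2 * CARD('n))) \<in> borel_measurable lborel"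
        by measurable
      show "AE B :: complex^'m^'m in lborel. 0 \<le> f (tr_sq B) * cmod (det B) ^ (2 * CARD('n))"
        using AE_tr_sq_pos by eventually_elim (use adm in \<open>simp add: admissible_def\<close>)
      have "ennreal (f u * d) = ennreal d * ennreal (f u)" if "0 \<le> d" for u d
        using that by (simp add: ennreal_mult' mult.commute)
      then show "(\<integral>\<^sup>+(B :: complex^'m^'m). ennreal (f (tr_sq B) * cmod (det B) ^ (2 * CARD('n))) \<partial>lborel) = ennreal C"
        using C[OF adm] by simp
    qed (rule \<open>0 \<le> C\<close>)
    show "distributed M lborel
          (\<lambda>\<omega>. matrix_inv (select_columns b (A \<omega>)) ** select_columns x (A \<omega>))
          (\<lambda>Z :: complex^'n^'m. ennreal (C / det_one_plus Z ^ (CARD('m) + CARD('n))))"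
      if "distributed M lborel A (\<lambda>a. ennreal (f (tr_sq a)))" "column_partition b x"
      for M :: "'w measure" and A :: "'w \<Rightarrow> complex^'k^'m" and b :: "'m \<Rightarrow> 'k" and x :: "'n \<Rightarrow> 'k"
      using block_quotient_distributed[OF adm \<open>0 \<le> C\<close> C[OF adm] that] .
  qed
qed

end
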